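(* Let $G$ be a type definable group in a strongly dependent theory $T$. Let $\{p_i(x,a_i)\mid i<\omega\}$ be a family of partial types, each $p_i(\mathfrak{C},a_i)$ being a (type definable) subgroup of $G$, such that $\langle a_i\mid i<\omega\rangle$ is an indiscernible sequence and $p_{2i}=p_{2i+1}$ for all $i<\omega$. Then there is some $i<\omega$ such that $\bigcap_{j<\omega,\,j\ne i}p_j(\mathfrak{C},a_j)=\bigcap_{j<\omega}p_j(\mathfrak{C},a_j)$. In particular, this is true when $p_i=p$ is constant.
   Context: $T$ is a complete first order theory and $\mathfrak{C}$ is its monster model (a very big saturated model containing all small models). The types $p_i(x,y)$ are partial types without further parameters. Type definable group: given by a partial type $\Sigma(x)$ ($x$ a finite tuple), possibly over a small set of parameters, and a formula $\nu(x,y,z)$ such that $\langle \Sigma(\mathfrak{C}),\nu\rangle$ is a group with $\nu$ defining the (graph of the) group operation. Indiscernible array: $\langle a_{i,j}\mid i,j<\omega\rangle$ (tuples) is an indiscernible array over $A$ if for each $i_0<\omega$ the row $\langle a_{i_0,j}\mid j<\omega\rangle$ is indiscernible over $A\cup\{a_{i,j}\mid i\ne i_0,\ i,j<\omega\}$. Strongly dependent: $T$ is not strongly dependent if there are formulas $\langle\varphi_i(x,y_i)\mid i<\omega\rangle$ ($x$ a fixed finite tuple of variables) and an array $\langle a_{i,j}\mid i,j<\omega\rangle$ which is an indiscernible array over $\emptyset$ such that the set $\{\varphi_i(x,a_{i,0})\wedge\neg\varphi_i(x,a_{i,1})\mid i<\omega\}$ is consistent. $T$ is strongly dependent if no such configuration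 exists. *)

theory Defs
  imports "HOL-Algebra.Group"
begin

unbundle cardinal_syntax

text \<open>
  First-order logic with equality, one sort. Bound variables are de Bruijn indices; free variables
  come from an arbitrary type \<^typ>\<open>'v\<close>, so that a formula \<open>\<phi>(x,y)\<close> in tuples of variables \<open>x\<close>, \<open>y\<close>
  indexed by \<^typ>\<open>'x\<close>, \<^typ>\<open>'y\<close> has free variables in \<^typ>\<open>'x + 'y\<close>. Infinite index types are allowed;
  a single formula still has only finitely many free variables.
\<close>

record ('f, 'r) lang =
  funs :: "'f set"
  rels :: "'r set"
  farity :: "'f \<Rightarrow> nat"
  rarity :: "'r \<Rightarrow> nat"

datatype (dead 'f, fvt: 'v) tm =
    Free 'v
  | Bound nat
  | App 'f "('f, 'v) tm list"

datatype (dead 'f, dead 'r, fv: 'v) fm =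
    Eq "('f, 'v) tm" "('f, 'v) tm"
  | Rel 'r "('f, 'v) tm list"
  | Neg "('f, 'r, 'v) fm"
  | Conj "('f, 'r, 'v) fm" "('f, 'r, 'v) fm"
  | Ex "('f, 'r, 'v) fm"

text \<open>The argument \<open>n\<close> is the number of enclosing quantifiers: no index may dangle.\<close>

fun wf_tm :: "('f, 'r) lang \<Rightarrow> nat \<Rightarrow> ('f, 'v) tm \<Rightarrow> bool" where
  "wf_tm L n (Free v) \<longleftrightarrow> True"
| "wf_tm L n (Bound k) \<longleftrightarrow> k < n"
| "wf_tm L n (App f ts) \<longleftrightarrow> f \<in> funs L \<and> length ts = farity L f \<and> (\<forall>t\<in>set ts. wf_tm L n t)"

fun wf_fm :: "('f, 'r) lang \<Rightarrow> nat \<Rightarrow> ('f, 'r, 'v) fm \<Rightarrow> bool" where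
  "wf_fm L n (Eq t u) \<longleftrightarrow> wf_tm L n t \<and> wf_tm L n u"
| "wf_fm L n (Rel R ts) \<longleftrightarrow> R \<in> rels L \<and> length ts = rarity L R \<and> (\<forall>t\<in>set ts. wf_tm L n t)"
| "wf_fm L n (Neg \<phi>) \<longleftrightarrow> wf_fm L n \<phi>"
| "wf_fm L n (Conj \<phi> \<psi>) \<longleftrightarrow> wf_fm L n \<phi> \<and> wf_fm L n \<psi>"
| "wf_fm L n (Ex \<phi>) \<longleftrightarrow> wf_fm L (Suc n) \<phi>"

definition formulas :: "('f, 'r) lang \<Rightarrow> ('f, 'r, 'v) fm set" where
  "formulas L = {\<phi>. wf_fm L 0 \<phi>}"

definition sentences :: "('f, 'r) lang \<Rightarrow> ('f, 'r, nat) fm set" where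
  "sentences L = {\<phi> \<in> formulas L. fv \<phi> = {}}"

text \<open>
  The universe of a structure is the whole type \<^typ>\<open>'m\<close>. The interpretation of a symbol matters
  only on lists whose length is the arity of the symbol.
\<close>

record ('f, 'r, 'm) str =
  fint :: "'f \<Rightarrow> 'm list \<Rightarrow> 'm"
  rint :: "'r \<Rightarrow> 'm list \<Rightarrow> bool"

primrec val :: "('f, 'r, 'm) str \<Rightarrow> ('v \<Rightarrow> 'm) \<Rightarrow> 'm list \<Rightarrow> ('f, 'v) tm \<Rightarrow> 'm" where
  "val M e bs (Free v) = e v"
| "val M e bs (Bound k) = bs ! k"
| "val M e bs (App f ts) = fint M f (map (val M e bs) ts)"

primrec sat :: "('f, 'r, 'm) str \<Rightarrow> ('v \<Rightarrow> 'm) \<Rightarrow> 'm list \<Rightarrow> ('f, 'r, 'v) fm \<Rightarrow> bool" where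
  "sat M e bs (Eq t u) \<longleftrightarrow> val M e bs t = val M e bs u"
| "sat M e bs (Rel R ts) \<longleftrightarrow> rint M R (map (val M e bs) ts)"
| "sat M e bs (Neg \<phi>) \<longleftrightarrow> \<not> sat M e bs \<phi>"
| "sat M e bs (Conj \<phi> \<psi>) \<longleftrightarrow> sat M e bs \<phi> \<and> sat M e bs \<psi>"
| "sat M e bs (Ex \<phi>) \<longleftrightarrow> (\<exists>b. sat M e (b # bs) \<phi>)"

definition models :: "('f, 'r, 'm) str \<Rightarrow> ('f, 'r, nat) fm set \<Rightarrow> bool" where
  "models M T \<longleftrightarrow> (\<forall>\<phi>\<in>T. \<forall>e. sat M e [] \<phi>)"

text \<open>
  A theory is identified with its set of consequences, so completeness is maximality; consistency
  is supplied by the model that accompanies \<open>T\<close> throughout.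
\<close>

definition complete_theory :: "('f, 'r) lang \<Rightarrow> ('f, 'r, nat) fm set \<Rightarrow> bool" where
  "complete_theory L T \<longleftrightarrow>
     T \<subseteq> sentences L \<and> (\<forall>\<phi>\<in>sentences L. \<phi> \<in> T \<or> Neg \<phi> \<in> T)"

text \<open>
  A formula with parameters from \<open>M\<close> in variables \<^typ>\<open>'v\<close> has its free variables in
  \<^typ>\<open>'v + 'm\<close>, where \<open>Inr m\<close> stands for the parameter \<open>m\<close>.
\<close>

definition formulas_over :: "('f, 'r) lang \<Rightarrow> 'm set \<Rightarrow> ('f, 'r, 'v + 'm) fm set" where
  "formulas_over L A = {\<psi> \<in> formulas L. Inr -` fv \<psi> \<subseteq> A}"

definition holds :: "('f, 'r, 'm) str \<Rightarrow> ('v \<Rightarrow> 'm) \<Rightarrow> ('f, 'r, 'v + 'm) fm \<Rightarrow> bool" where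
  "holds M c \<psi> \<longleftrightarrow> sat M (case_sum c id) [] \<psi>"

text \<open>\<open>inst a \<phi>\<close> is \<open>\<phi>(x,a)\<close>.\<close>

definition inst :: "('y \<Rightarrow> 'm) \<Rightarrow> ('f, 'r, 'x + 'y) fm \<Rightarrow> ('f, 'r, 'x + 'm) fm" where
  "inst a = map_fm (map_sum id a)"

text \<open>\<open>\<Gamma>(M)\<close>, the set of realisations in \<open>M\<close>.\<close>

definition realisations ::
  "('f, 'r, 'm) str \<Rightarrow> ('f, 'r, 'v + 'm) fm set \<Rightarrow> ('v \<Rightarrow> 'm) set" where
  "realisations M \<Gamma> = {c. \<forall>\<psi>\<in>\<Gamma>. holds M c \<psi>}"

text \<open>
  Consistency, modulo the elementary diagram of \<open>M\<close>, of a set of formulas with parameters in \<open>M\<close>.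
\<close>

definition consistent :: "('f, 'r, 'm) str \<Rightarrow> ('f, 'r, 'v + 'm) fm set \<Rightarrow> bool" where
  "consistent M \<Gamma> \<longleftrightarrow> (\<forall>\<Delta> \<subseteq> \<Gamma>. finite \<Delta> \<longrightarrow> realisations M \<Delta> \<noteq> {})"

definition small :: "('f, 'r, 'm) str \<Rightarrow> 'b set \<Rightarrow> bool" where
  "small M S \<longleftrightarrow> |S| <o |UNIV :: 'm set|"

text \<open>Saturation: every 1-type over a small set of parameters is realised.\<close>

definition saturated :: "('f, 'r) lang \<Rightarrow> ('f, 'r, 'm) str \<Rightarrow> bool" where
  "saturated L M \<longleftrightarrow>
     (\<forall>A. small M A \<longrightarrow>
       (\<forall>\<Gamma> :: ('f, 'r, unit + 'm) fm set.
          \<Gamma> \<subseteq> formulas_over L A \<and> consistent M \<Gamma> \<longrightarrow> realisations M \<Gamma> \<noteq> {}))"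

text \<open>
  How big a monster model has to be varies with the context; here its cardinality exceeds
  \<open>|L| + \<aleph>\<^sub>0\<close>, and small means of smaller cardinality than the monster. That every small model
  embeds elementarily is a consequence of saturation.
\<close>

definition monster_model ::
  "('f, 'r) lang \<Rightarrow> ('f, 'r, nat) fm set \<Rightarrow> ('f, 'r, 'm) str \<Rightarrow> bool" where
  "monster_model L T M \<longleftrightarrow>
     models M T \<and> saturated L M \<and>
     small M (UNIV :: nat set) \<and> small M (funs L) \<and> small M (rels L)"

text \<open>
  A sequence of tuples \<open>(a l k)\<^sub>k\<close>, where \<open>k\<close> ranges over \<open>K\<close>, is indiscernible over \<open>A\<close>. The variable
  \<open>Inl (l, k)\<close> stands for the \<open>k\<close>-th entry of the \<open>l\<close>-th tuple of variables. As formulas are finite,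
  infinite increasing index sequences \<open>s\<close>, \<open>t\<close> give the same notion as finite ones.
\<close>

definition indiscernible ::
  "('f, 'r) lang \<Rightarrow> ('f, 'r, 'm) str \<Rightarrow> 'm set \<Rightarrow> 'k set \<Rightarrow> (nat \<Rightarrow> 'k \<Rightarrow> 'm) \<Rightarrow> bool" where
  "indiscernible L M A K a \<longleftrightarrow>
     (\<forall>\<psi> :: ('f, 'r, (nat \<times> 'k) + 'm) fm. \<forall>s t :: nat \<Rightarrow> nat.
        \<psi> \<in> formulas_over L A \<and> Inl -` fv \<psi> \<subseteq> UNIV \<times> K \<and> strict_mono s \<and> strict_mono t \<longrightarrow>
        (holds M (\<lambda>(l, k). a (s l) k) \<psi> \<longleftrightarrow> holds M (\<lambda>(l, k). a (t l) k) \<psi>))"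

text \<open>The tuples in row \<open>i\<close> are indexed by \<open>K i\<close>.\<close>

definition indiscernible_array ::
  "('f, 'r) lang \<Rightarrow> ('f, 'r, 'm) str \<Rightarrow> 'm set \<Rightarrow> (nat \<Rightarrow> 'k set) \<Rightarrow> (nat \<Rightarrow> nat \<Rightarrow> 'k \<Rightarrow> 'm) \<Rightarrow> bool"
  where
  "indiscernible_array L M A K a \<longleftrightarrow>
     (\<forall>i0. indiscernible L M (A \<union> {a i j k | i j k. i \<noteq> i0 \<and> k \<in> K i}) (K i0) (a i0))"

text \<open>
  A property of the theory of \<open>M\<close>, read off in the monster model \<open>M\<close>. Here \<open>x\<close> has length \<open>n\<close> and
  \<open>y\<^sub>i\<close> has length \<open>m i\<close>.
\<close>

definition strongly_dependent :: "('f, 'r) lang \<Rightarrow> ('f, 'r, 'm) str \<Rightarrow> bool" where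
  "strongly_dependent L M \<longleftrightarrow>
     \<not> (\<exists>(n :: nat) (m :: nat \<Rightarrow> nat) (\<phi> :: nat \<Rightarrow> ('f, 'r, nat + nat) fm)
          (a :: nat \<Rightarrow> nat \<Rightarrow> nat \<Rightarrow> 'm).
          (\<forall>i. \<phi> i \<in> formulas L \<and> fv (\<phi> i) \<subseteq> {..<n} <+> {..<m i}) \<and>
          indiscernible_array L M {} (\<lambda>i. {..<m i}) a \<and>
          consistent M (range (\<lambda>i. Conj (inst (a i 0) (\<phi> i)) (Neg (inst (a i 1) (\<phi> i))))))"

text \<open>
  The group \<open>G\<close> has universe \<open>\<Sigma>(M)\<close>, and \<open>\<nu>(x,y,z)\<close> defines the graph of its multiplication; both
  \<open>\<Sigma>\<close> and \<open>\<nu>\<close> may use the small set \<open>B\<close> of parameters.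
\<close>

definition type_definable_group ::
  "('f, 'r) lang \<Rightarrow> ('f, 'r, 'm) str \<Rightarrow> ('x::finite \<Rightarrow> 'm) monoid \<Rightarrow> bool" where
  "type_definable_group L M G \<longleftrightarrow>
     group G \<and>
     (\<exists>(B :: 'm set) (\<Sigma> :: ('f, 'r, 'x + 'm) fm set) (\<nu> :: ('f, 'r, ('x + 'x + 'x) + 'm) fm).
        small M B \<and> \<Sigma> \<subseteq> formulas_over L B \<and> \<nu> \<in> formulas_over L B \<and>
        carrier G = realisations M \<Sigma> \<and>
        (\<forall>a\<in>carrier G. \<forall>b\<in>carrier G. \<forall>c\<in>carrier G.
           holds M (case_sum a (case_sum b c)) \<nu> \<longleftrightarrow> a \<otimes>\<^bsub>G\<^esub> b = c))"

end

theory Submission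
  imports Defs "HOL-Library.Countable_Set" "HOL-Library.Product_Lexorder"
begin

text \<open>
  Write \<open>H\<^sub>j\<close> for the subgroup defined by \<open>p\<^sub>j(x,a\<^sub>j)\<close> and suppose that no \<open>H\<^sub>i\<close> can be left out of the
  intersection. Then for every \<open>i\<close> there is an element \<open>b\<^sub>i\<close> that lies in \<open>H\<^sub>j\<close> for all \<open>j \<noteq> i\<close> but not in
  \<open>H\<^sub>i\<close>. Pair up the indices and use only the odd \<open>b\<^sub>i\<close>: the product \<open>c = b\<^sub>1b\<^sub>3\<dots>b\<^sub>2\<^sub>n\<^sub>-\<^sub>1\<close> lies in every
  \<open>H\<^sub>2\<^sub>i\<close>, and it lies outside \<open>H\<^sub>2\<^sub>i\<^sub>+\<^sub>1\<close> for every \<open>i < n\<close>, because exactly one factor does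
  (\<open>product_with_one_bad_factor_each\<close>).

  Strong dependence speaks of formulas, so the second fact has to be witnessed by one formula \<open>\<phi>\<^sub>i\<close> that
  does not depend on \<open>n\<close>. Some \<open>\<psi> \<in> p\<^sub>2\<^sub>i\<^sub>+\<^sub>1\<close> fails at \<open>b\<^sub>2\<^sub>i\<^sub>+\<^sub>1\<close>. As \<open>H\<^sub>2\<^sub>i\<^sub>+\<^sub>1\<close> is closed under multiplication,
  compactness gives a finite conjunction \<open>\<phi>\<^sub>i\<close> of members of \<open>p\<^sub>2\<^sub>i\<^sub>+\<^sub>1\<close> such that \<open>\<phi>\<^sub>i(c)\<close> implies \<open>\<psi>(ucv)\<close>
  for all \<open>u,v \<in> H\<^sub>2\<^sub>i\<^sub>+\<^sub>1\<close> (\<open>type_definable_subgroup_separation\<close>). Since \<open>b\<^sub>2\<^sub>i\<^sub>+\<^sub>1\<close> is obtained from \<open>c\<close> by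
  multiplying with elements of \<open>H\<^sub>2\<^sub>i\<^sub>+\<^sub>1\<close> on both sides, \<open>\<phi>\<^sub>i(c,a\<^sub>2\<^sub>i\<^sub>+\<^sub>1)\<close> fails. On the other hand
  \<open>\<phi>\<^sub>i(c,a\<^sub>2\<^sub>i)\<close> holds, because \<open>p\<^sub>2\<^sub>i = p\<^sub>2\<^sub>i\<^sub>+\<^sub>1\<close> contains all conjuncts of \<open>\<phi>\<^sub>i\<close>.

  So every finite part of \<open>{\<phi>\<^sub>i(x,a\<^sub>2\<^sub>i) \<and> \<not> \<phi>\<^sub>i(x,a\<^sub>2\<^sub>i\<^sub>+\<^sub>1) | i < \<omega>}\<close> is realised. By saturation the indiscernible
  sequence has the same finite patterns as a sequence ordered like \<open>\<omega> \<times> \<omega>\<close> lexicographically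
  (\<open>lexicographic_array\<close>). The rows of the latter form an indiscernible array
  (\<open>lexicographic_array_indiscernible\<close>), and its first two columns look like the pairs
  \<open>a\<^sub>2\<^sub>i, a\<^sub>2\<^sub>i\<^sub>+\<^sub>1\<close>. This contradicts strong dependence (\<open>alternation_not_strongly_dependent\<close>).

  Saturation, which is about one variable, is brought into play through
  \<open>saturated_realises_countable_types\<close>: types in countably many variables over small sets are realised.
\<close>

section \<open>Satisfaction, renaming of variables and finite conjunctions\<close>

lemma val_cong: "(\<And>v. v \<in> fvt t \<Longrightarrow> e v = e' v) \<Longrightarrow> val M e bs t = val M e' bs t"
proof (induction t)
  case (App f ts)
  then have "map (val M e bs) ts = map (val M e' bs) ts"
    by (intro map_cong) auto
  then show ?case by (simp del: map_eq_conv)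
qed auto

lemma sat_cong: "(\<And>v. v \<in> fv \<phi> \<Longrightarrow> e v = e' v) \<Longrightarrow> sat M e bs \<phi> \<longleftrightarrow> sat M e' bs \<phi>"
proof (induction \<phi> arbitrary: bs)
  case (Eq t u)
  then show ?case using val_cong[of t e e' M bs] val_cong[of u e e' M bs] by simp
next
  case (Rel R ts)
  then have "map (val M e bs) ts = map (val M e' bs) ts"
    by (auto intro!: val_cong)
  then show ?case by (simp del: map_eq_conv)
next
  case (Neg \<phi>)
  then show ?case by simp
next
  case (Conj \<phi> \<psi>)
  have "sat M e bs \<phi> \<longleftrightarrow> sat M e' bs \<phi>" "sat M e bs \<psi> \<longleftrightarrow> sat M e' bs \<psi>"
    using Conj by simp_all
  then show ?case by simp
next
  case (Ex \<phi>)
  then show ?case by simp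
qed

lemma val_map: "val M e bs (map_tm r t) = val M (e \<circ> r) bs t"
  by (induction t) (auto simp: o_def cong: map_cong)

lemma sat_map: "sat M e bs (map_fm r \<phi>) \<longleftrightarrow> sat M (e \<circ> r) bs \<phi>"
  by (induction \<phi> arbitrary: bs) (auto simp: val_map o_def cong: map_cong)

lemma wf_tm_map: "wf_tm L n (map_tm r t) \<longleftrightarrow> wf_tm L n t"
  by (induction t) auto

lemma wf_fm_map: "wf_fm L n (map_fm r \<phi>) \<longleftrightarrow> wf_fm L n \<phi>"
  by (induction \<phi> arbitrary: n) (auto simp: wf_tm_map)

lemma map_in_formulas: "map_fm r \<phi> \<in> formulas L \<longleftrightarrow> \<phi> \<in> formulas L"
  by (simp add: formulas_def wf_fm_map)

lemma rename_formulas_over: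
  fixes r :: "'v \<Rightarrow> 'w" and \<phi> :: "('f, 'r, 'v + 'm) fm"
  shows "map_fm (map_sum r id) \<phi> \<in> formulas_over L A \<longleftrightarrow> \<phi> \<in> formulas_over L A"
proof -
  have "Inr -` (map_sum r id ` X) = (Inr -` X :: 'm set)" for X
    by (auto simp: map_sum_def image_iff split: sum.splits)
  then show ?thesis by (simp add: formulas_over_def map_in_formulas fm.set_map)
qed

lemma holds_map: "holds M c (map_fm r \<phi>) \<longleftrightarrow> sat M (case_sum c id \<circ> r) [] \<phi>"
  by (simp add: holds_def sat_map)

lemma holds_inst: "holds M c (inst a \<phi>) \<longleftrightarrow> sat M (case_sum c a) [] \<phi>"
  unfolding inst_def holds_map
  by (rule sat_cong) (auto split: sum.splits)

lemma finite_fvt: "finite (fvt t)"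
  by (induction t) auto

lemma finite_fv: "finite (fv \<phi>)"
  by (induction \<phi>) (auto simp: finite_fvt)

lemma finite_conjunction:
  assumes "finite \<Delta>" "\<Delta> \<subseteq> formulas L"
  shows "\<exists>\<theta>\<in>formulas L. fv \<theta> = \<Union> (fv ` \<Delta>) \<and>
    (\<forall>M :: ('f, 'r, 'm) str. \<forall>e. sat M e [] \<theta> \<longleftrightarrow> (\<forall>\<psi>\<in>\<Delta>. sat M e [] \<psi>))"
  using assms
proof (induction \<Delta>)
  case empty
  show ?case
    by (rule bexI[of _ "Ex (Eq (Bound 0) (Bound 0))"]) (auto simp: formulas_def)
next
  case (insert \<psi> \<Delta>)
  then obtain \<theta> where "\<theta> \<in> formulas L" "fv \<theta> = \<Union> (fv ` \<Delta>)"
    "\<forall>M :: ('f, 'r, 'm) str. \<forall>e. sat M e [] \<theta> \<longleftrightarrow> (\<forall>\<psi>\<in>\<Delta>. sat M e [] \<psi>)"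
    by auto
  with insert show ?case
    by (intro bexI[of _ "Conj \<psi> \<theta>"]) (auto simp: formulas_def)
qed

section \<open>Quantifying free variables\<close>

text \<open>
  The free variable \<open>v\<close> is abstracted for a quantifier placed in front of the whole formula. Seen from
  below \<open>k\<close> quantifiers this outermost quantifier has de Bruijn index \<open>k\<close>.
\<close>

primrec bind_tm :: "'v \<Rightarrow> nat \<Rightarrow> ('f, 'v) tm \<Rightarrow> ('f, 'v) tm" where
  "bind_tm v k (Free w) = (if w = v then Bound k else Free w)"
| "bind_tm v k (Bound j) = Bound j"
| "bind_tm v k (App f ts) = App f (map (bind_tm v k) ts)"

primrec bind_fm :: "'v \<Rightarrow> nat \<Rightarrow> ('f, 'r, 'v) fm \<Rightarrow> ('f, 'r, 'v) fm" where
  "bind_fm v k (Eq t u) = Eq (bind_tm v k t) (bind_tm v k u)"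
| "bind_fm v k (Rel R ts) = Rel R (map (bind_tm v k) ts)"
| "bind_fm v k (Neg \<phi>) = Neg (bind_fm v k \<phi>)"
| "bind_fm v k (Conj \<phi> \<psi>) = Conj (bind_fm v k \<phi>) (bind_fm v k \<psi>)"
| "bind_fm v k (Ex \<phi>) = Ex (bind_fm v (Suc k) \<phi>)"

lemma wf_bind_tm: "wf_tm L k t \<Longrightarrow> wf_tm L (Suc k) (bind_tm v k t)"
  by (induction t) auto

lemma wf_bind_fm: "wf_fm L k \<phi> \<Longrightarrow> wf_fm L (Suc k) (bind_fm v k \<phi>)"
  by (induction \<phi> arbitrary: k) (auto simp: wf_bind_tm)

lemma fvt_bind_tm: "fvt (bind_tm v k t) = fvt t - {v}"
  by (induction t) auto

lemma fv_bind_fm: "fv (bind_fm v k \<phi>) = fv \<phi> - {v}"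
  by (induction \<phi> arbitrary: k) (auto simp: fvt_bind_tm)

lemma val_bind_tm:
  "wf_tm L (length bs) t \<Longrightarrow>
    val M e (bs @ [b]) (bind_tm v (length bs) t) = val M (e(v := b)) bs t"
  by (induction t) (auto simp: nth_append cong: map_cong)

lemma sat_bind_fm:
  "wf_fm L (length bs) \<phi> \<Longrightarrow>
    sat M e (bs @ [b]) (bind_fm v (length bs) \<phi>) \<longleftrightarrow> sat M (e(v := b)) bs \<phi>"
proof (induction \<phi> arbitrary: bs)
  case (Rel R ts)
  then have "map (val M e (bs @ [b])) (map (bind_tm v (length bs)) ts) = map (val M (e(v := b)) bs) ts"
    by (auto simp: val_bind_tm)
  then show ?case by (simp only: bind_fm.simps sat.simps)
next
  case (Ex \<phi>)
  then show ?case by (metis append_Cons bind_fm.simps(5) length_Cons sat.simps(5) wf_fm.simps(5))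
qed (auto simp: val_bind_tm)

text \<open>
  Quantifying the variables in \<open>S\<close> one after the other keeps the type of the formula; satisfaction becomes
  existence of an assignment that is changed on \<open>S\<close> only.
\<close>

lemma existential_closure:
  assumes "finite S" "\<phi> \<in> formulas L"
  shows "\<exists>\<theta>\<in>formulas L. fv \<theta> = fv \<phi> - S \<and>
    (\<forall>M :: ('f, 'r, 'm) str. \<forall>e.
       sat M e [] \<theta> \<longleftrightarrow> (\<exists>e'. (\<forall>v. v \<notin> S \<longrightarrow> e' v = e v) \<and> sat M e' [] \<phi>))"
  using assms(1)
proof (induction S)
  case empty
  have "e' = e \<longleftrightarrow> (\<forall>v. e' v = e v)" for e e' :: "'c \<Rightarrow> 'm"
    by auto
  with assms(2) show ?case
    by (intro bexI[of _ \<phi>]) (auto simp: fun_eq_iff[symmetric])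
next
  case (insert s S)
  then obtain \<theta> where \<theta>: "\<theta> \<in> formulas L" "fv \<theta> = fv \<phi> - S"
    "\<And>(M :: ('f, 'r, 'm) str) e.
       sat M e [] \<theta> \<longleftrightarrow> (\<exists>e'. (\<forall>v. v \<notin> S \<longrightarrow> e' v = e v) \<and> sat M e' [] \<phi>)"
    by auto
  \<comment> \<open>An empty stack of bound values, so the new quantifier is the only one around.\<close>
  have bind: "sat M e [] (Ex (bind_fm s 0 \<theta>)) \<longleftrightarrow> (\<exists>b. sat M (e(s := b)) [] \<theta>)"
    for M :: "('f, 'r, 'm) str" and e
    using sat_bind_fm[of L "[]" \<theta> M e _ s] \<theta>(1) by (simp add: formulas_def)
  have "sat M e [] (Ex (bind_fm s 0 \<theta>)) \<longleftrightarrow>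
     (\<exists>e'. (\<forall>v. v \<notin> insert s S \<longrightarrow> e' v = e v) \<and> sat M e' [] \<phi>)"
    for M :: "('f, 'r, 'm) str" and e
  proof
    assume "sat M e [] (Ex (bind_fm s 0 \<theta>))"
    then obtain b e' where "\<forall>v. v \<notin> S \<longrightarrow> e' v = (e(s := b)) v" "sat M e' [] \<phi>"
      unfolding bind \<theta>(3) by blast
    then show "\<exists>e'. (\<forall>v. v \<notin> insert s S \<longrightarrow> e' v = e v) \<and> sat M e' [] \<phi>"
      by (intro exI[of _ e']) auto
  next
    assume "\<exists>e'. (\<forall>v. v \<notin> insert s S \<longrightarrow> e' v = e v) \<and> sat M e' [] \<phi>"
    then obtain e' where "\<forall>v. v \<notin> insert s S \<longrightarrow> e' v = e v" "sat M e' [] \<phi>"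
      by blast
    then show "sat M e [] (Ex (bind_fm s 0 \<theta>))"
      unfolding bind \<theta>(3) by (intro exI[of _ "e' s"] exI[of _ e']) auto
  qed
  then show ?case
    using \<theta>(1,2)
    by (intro bexI[of _ "Ex (bind_fm s 0 \<theta>)"]) (auto simp: formulas_def wf_bind_fm fv_bind_fm)
qed

section \<open>Types in countably many variables\<close>

definition finitely_satisfiable_at ::
  "('f, 'r, 'm) str \<Rightarrow> ('f, 'r, 'v + 'm) fm set \<Rightarrow> 'v set \<Rightarrow> ('v \<Rightarrow> 'm) \<Rightarrow> bool" where
  "finitely_satisfiable_at M \<Gamma> F e \<longleftrightarrow>
     (\<forall>\<Delta>\<subseteq>\<Gamma>. finite \<Delta> \<longrightarrow> (\<exists>c. (\<forall>v\<in>F. c v = e v) \<and> (\<forall>\<psi>\<in>\<Delta>. holds M c \<psi>)))"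

lemma infinite_universe: "small M (UNIV :: nat set) \<Longrightarrow> infinite (UNIV :: 'm set)"
  for M :: "('f, 'r, 'm) str"
  unfolding small_def
  using card_of_ordLeq_finite[OF ordLess_imp_ordLeq] infinite_UNIV_nat by blast

lemma small_Un:
  fixes M :: "('f, 'r, 'm) str"
  assumes "small M (UNIV :: nat set)" "small M A" "small M B"
  shows "small M (A \<union> B)"
  using assms infinite_universe[OF assms(1)]
  unfolding small_def by (simp add: card_of_Un_ordLess_infinite)

lemma small_image: "small M A \<Longrightarrow> small M (f ` A)"
  unfolding small_def by (rule ordLeq_ordLess_trans[OF card_of_image])

lemma small_finite:
  fixes M :: "('f, 'r, 'm) str"
  assumes "small M (UNIV :: nat set)" "finite A"
  shows "small M A"
proof -
  have "|A| <o natLeq"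
    using assms(2) by (simp only: finite_iff_ordLess_natLeq)
  then have "|A| <o |UNIV :: nat set|"
    by (rule ordLess_ordIso_trans[OF _ ordIso_symmetric[OF card_of_nat]])
  then show ?thesis
    using assms(1) unfolding small_def by (rule ordLess_transitive)
qed

text \<open>
  One step of the realisation of a type: the variables in \<open>F\<close> already have values, and \<open>v\<close> is given one.
  For finite \<open>\<Delta> \<subseteq> \<Gamma>\<close> let \<open>\<theta>\<^sub>\<Delta>(v)\<close> say that the remaining variables can be chosen such that \<open>\<Delta>\<close> holds; the
  values on \<open>F\<close> become parameters. These formulas form a type in one variable over a small set: finitely
  many of them are implied by the one that belongs to the union of the sets \<open>\<Delta>\<close>. Saturation
  realises it.
\<close>

lemma realise_one_variable:
  fixes M :: "('f, 'r, 'm) str" and \<Gamma> :: "('f, 'r, 'v + 'm) fm set"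
  assumes sat: "saturated L M" and unc: "small M (UNIV :: nat set)"
    and A: "small M A" and F: "finite F" and \<Gamma>: "\<Gamma> \<subseteq> formulas_over L A"
    and fs: "finitely_satisfiable_at M \<Gamma> F e"
  shows "\<exists>b. finitely_satisfiable_at M \<Gamma> (insert v F) (e(v := b))"
proof (cases "v \<in> F")
  case True
  then have "insert v F = F" "e(v := e v) = e" by auto
  with fs show ?thesis by metis
next
  case False
  have small: "small M (A \<union> e ` F)"
    using small_Un[OF unc A small_finite[OF unc]] F by blast
  have ex: "\<exists>\<theta> :: ('f, 'r, unit + 'm) fm. \<theta> \<in> formulas_over L (A \<union> e ` F) \<and>
      (\<forall>b. holds M (\<lambda>_. b) \<theta> \<longleftrightarrow>
        (\<exists>c. (\<forall>w\<in>insert v F. c w = (e(v := b)) w) \<and> (\<forall>\<psi>\<in>\<Delta>. holds M c \<psi>)))"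
    if \<Delta>: "finite \<Delta>" "\<Delta> \<subseteq> \<Gamma>" for \<Delta>
  proof -
    have "\<Delta> \<subseteq> formulas L"
      using \<Delta> \<Gamma> by (auto simp: formulas_over_def)
    then obtain \<kappa> where \<kappa>: "\<kappa> \<in> formulas L" "fv \<kappa> = \<Union> (fv ` \<Delta>)"
      "\<And>e. sat M e [] \<kappa> \<longleftrightarrow> (\<forall>\<psi>\<in>\<Delta>. sat M e [] \<psi>)"
      using finite_conjunction[OF \<Delta>(1)] by metis
    \<comment> \<open>The variables of \<open>\<Delta>\<close> other than \<open>v\<close> that have no value yet.\<close>
    define S :: "('v + 'm) set" where "S = fv \<kappa> \<inter> Inl ` (- insert v F)"
    have "finite S" by (simp add: S_def finite_fv)
    then obtain \<theta> where \<theta>: "\<theta> \<in> formulas L" "fv \<theta> = fv \<kappa> - S"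
      "\<And>e. sat M e [] \<theta> \<longleftrightarrow> (\<exists>e'. (\<forall>v. v \<notin> S \<longrightarrow> e' v = e v) \<and> sat M e' [] \<kappa>)"
      using existential_closure[OF _ \<kappa>(1)] by metis
    \<comment> \<open>\<open>v\<close> becomes the single variable, the variables in \<open>F\<close> turn into their values.\<close>
    define r :: "'v + 'm \<Rightarrow> unit + 'm"
      where "r = case_sum (\<lambda>w. if w = v then Inl () else Inr (e w)) Inr"
    have E: "case_sum (\<lambda>_. b) id \<circ> r = case_sum (e(v := b)) id" for b
      by (auto simp: r_def fun_eq_iff split: sum.splits)
    have "holds M (\<lambda>_. b) (map_fm r \<theta>) \<longleftrightarrow>
        (\<exists>c. (\<forall>w\<in>insert v F. c w = (e(v := b)) w) \<and> (\<forall>\<psi>\<in>\<Delta>. holds M c \<psi>))" for b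
    proof
      assume "holds M (\<lambda>_. b) (map_fm r \<theta>)"
      then obtain e' where e': "\<forall>x. x \<notin> S \<longrightarrow> e' x = case_sum (e(v := b)) id x" "sat M e' [] \<kappa>"
        unfolding holds_map E \<theta>(3) by blast
      then have "e' = case_sum (e' \<circ> Inl) id"
        by (auto simp: fun_eq_iff S_def split: sum.splits)
      then have "\<forall>\<psi>\<in>\<Delta>. holds M (e' \<circ> Inl) \<psi>"
        using e'(2) by (auto simp: holds_def \<kappa>(3))
      moreover have "\<forall>w\<in>insert v F. (e' \<circ> Inl) w = (e(v := b)) w"
        using e'(1) by (auto simp: S_def)
      ultimately show "\<exists>c. (\<forall>w\<in>insert v F. c w = (e(v := b)) w) \<and> (\<forall>\<psi>\<in>\<Delta>. holds M c \<psi>)"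
        by blast
    next
      assume "\<exists>c. (\<forall>w\<in>insert v F. c w = (e(v := b)) w) \<and> (\<forall>\<psi>\<in>\<Delta>. holds M c \<psi>)"
      then obtain c where c: "\<forall>w\<in>insert v F. c w = (e(v := b)) w" "\<forall>\<psi>\<in>\<Delta>. holds M c \<psi>"
        by blast
      define e' where "e' x = (if x \<in> S then case_sum c id x else case_sum (e(v := b)) id x)" for x
      have "sat M e' [] \<kappa> \<longleftrightarrow> sat M (case_sum c id) [] \<kappa>"
        by (rule sat_cong) (use c(1) in \<open>auto simp: e'_def S_def split: sum.splits\<close>)
      then have "sat M e' [] \<kappa>"
        using c(2) by (simp add: \<kappa>(3) holds_def)
      then show "holds M (\<lambda>_. b) (map_fm r \<theta>)"
        unfolding holds_map E \<theta>(3) by (intro exI[of _ e']) (auto simp: e'_def)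
    qed
    moreover have "map_fm r \<theta> \<in> formulas_over L (A \<union> e ` F)"
    proof -
      have params: "m \<in> A" if "Inr m \<in> fv \<kappa>" for m
        using that \<Delta>(2) \<Gamma> by (auto simp: \<kappa>(2) formulas_over_def)
      have inst_params: "m \<in> A \<union> e ` F" if "x \<in> fv \<theta>" "r x = Inr m" for m x
      proof (cases x)
        case (Inl w)
        then have "w \<noteq> v" "e w = m"
          using that(2) by (auto simp: r_def split: if_splits)
        moreover have "w \<in> insert v F"
          using that(1) Inl unfolding \<theta>(2) S_def by blast
        ultimately show ?thesis by blast
      next
        case (Inr m')
        then show ?thesis
          using that params unfolding \<theta>(2) r_def by simp
      qed
      have "Inr -` fv (map_fm r \<theta>) \<subseteq> A \<union> e ` F"
      proof
        fix m assume "m \<in> Inr -` fv (map_fm r \<theta>)"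
        then have "Inr m \<in> r ` fv \<theta>" by (simp add: fm.set_map)
        then obtain x where "x \<in> fv \<theta>" "r x = Inr m" by (metis imageE)
        then show "m \<in> A \<union> e ` F" by (rule inst_params)
      qed
      then show ?thesis
        using \<theta>(1) by (simp add: formulas_over_def map_in_formulas)
    qed
    ultimately show ?thesis by blast
  qed
  then obtain \<Theta> :: "('f, 'r, 'v + 'm) fm set \<Rightarrow> ('f, 'r, unit + 'm) fm" where \<Theta>:
    "\<And>\<Delta>. finite \<Delta> \<Longrightarrow> \<Delta> \<subseteq> \<Gamma> \<Longrightarrow> \<Theta> \<Delta> \<in> formulas_over L (A \<union> e ` F)"
    "\<And>\<Delta> b. finite \<Delta> \<Longrightarrow> \<Delta> \<subseteq> \<Gamma> \<Longrightarrow> holds M (\<lambda>_. b) (\<Theta> \<Delta>) \<longleftrightarrow>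
        (\<exists>c. (\<forall>w\<in>insert v F. c w = (e(v := b)) w) \<and> (\<forall>\<psi>\<in>\<Delta>. holds M c \<psi>))"
    by metis
  define P where "P = \<Theta> ` {\<Delta>. finite \<Delta> \<and> \<Delta> \<subseteq> \<Gamma>}"
  have "consistent M P"
    unfolding consistent_def
  proof (intro allI impI)
    fix D assume "D \<subseteq> P" "finite D"
    then obtain Ds where Ds: "finite Ds" "Ds \<subseteq> {\<Delta>. finite \<Delta> \<and> \<Delta> \<subseteq> \<Gamma>}" "D = \<Theta> ` Ds"
      unfolding P_def by (meson finite_subset_image)
    then have "finite (\<Union> Ds)" "\<Union> Ds \<subseteq> \<Gamma>" by auto
    then obtain c where c: "\<forall>w\<in>F. c w = e w" "\<forall>\<psi>\<in>\<Union> Ds. holds M c \<psi>"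
      using fs unfolding finitely_satisfiable_at_def by blast
    have "holds M (\<lambda>_. c v) (\<Theta> \<Delta>)" if "\<Delta> \<in> Ds" for \<Delta>
      using that Ds(2) c False by (subst \<Theta>(2)) (auto intro!: exI[of _ c])
    then show "realisations M D \<noteq> {}"
      unfolding realisations_def Ds(3) by blast
  qed
  moreover have "P \<subseteq> formulas_over L (A \<union> e ` F)"
    by (auto simp: P_def \<Theta>(1))
  ultimately obtain c where c: "c \<in> realisations M P"
    using sat small unfolding saturated_def by blast
  define b where "b = c ()"
  have "c = (\<lambda>_. b)" by (auto simp: b_def)
  with c have b: "(\<lambda>_. b) \<in> realisations M P" by simp
  have "finitely_satisfiable_at M \<Gamma> (insert v F) (e(v := b))"
    unfolding finitely_satisfiable_at_def
  proof (intro allI impI)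
    fix \<Delta> assume \<Delta>: "\<Delta> \<subseteq> \<Gamma>" "finite \<Delta>"
    then have "holds M (\<lambda>_. b) (\<Theta> \<Delta>)"
      using b unfolding realisations_def P_def by blast
    then show "\<exists>c. (\<forall>w\<in>insert v F. c w = (e(v := b)) w) \<and> (\<forall>\<psi>\<in>\<Delta>. holds M c \<psi>)"
      using \<Theta>(2)[OF \<Delta>(2,1)] by blast
  qed
  then show ?thesis ..
qed

text \<open>
  The variables are given values in the order of an enumeration, keeping the type finitely satisfiable.
  A formula has finitely many variables, so it is decided at a finite stage, and it must then hold.
\<close>

theorem saturated_realises_countable_types:
  fixes M :: "('f, 'r, 'm) str" and \<Gamma> :: "('f, 'r, 'v::countable + 'm) fm set"
  assumes sat: "saturated L M" and unc: "small M (UNIV :: nat set)"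
    and A: "small M A" and \<Gamma>: "\<Gamma> \<subseteq> formulas_over L A" and con: "consistent M \<Gamma>"
  shows "realisations M \<Gamma> \<noteq> {}"
proof -
  define F where "F n = {v :: 'v. to_nat v < n}" for n
  have fin: "finite (F n)" for n
    using finite_vimageI[of "{..<n}" "to_nat :: 'v \<Rightarrow> nat"] by (auto simp: F_def vimage_def)
  have F_Suc: "F (Suc n) = F n \<or> (\<exists>v. v \<notin> F n \<and> F (Suc n) = insert v (F n))" for n
  proof (cases "n \<in> range (to_nat :: 'v \<Rightarrow> nat)")
    case True
    then obtain v :: 'v where "to_nat v = n" by auto
    then show ?thesis by (intro disjI2 exI[of _ v]) (auto simp: F_def less_Suc_eq)
  next
    case False
    then show ?thesis by (auto simp: F_def less_Suc_eq)
  qed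
  have "\<exists>f. \<forall>n. finitely_satisfiable_at M \<Gamma> (F n) (f n) \<and> (\<forall>v\<in>F n. f (Suc n) v = f n v)"
  proof (rule dependent_nat_choice)
    show "\<exists>e. finitely_satisfiable_at M \<Gamma> (F 0) e"
      using con by (auto simp: F_def finitely_satisfiable_at_def consistent_def realisations_def)
  next
    fix e n assume *: "finitely_satisfiable_at M \<Gamma> (F n) e"
    show "\<exists>e'. finitely_satisfiable_at M \<Gamma> (F (Suc n)) e' \<and> (\<forall>v\<in>F n. e' v = e v)"
      using F_Suc[of n]
    proof (elim disjE exE conjE)
      fix v assume v: "v \<notin> F n" "F (Suc n) = insert v (F n)"
      obtain b where "finitely_satisfiable_at M \<Gamma> (insert v (F n)) (e(v := b))"
        using realise_one_variable[OF sat unc A fin \<Gamma> *] by blast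
      then show ?thesis using v by (intro exI[of _ "e(v := b)"]) auto
    qed (use * in auto)
  qed
  then obtain f where f: "\<And>n. finitely_satisfiable_at M \<Gamma> (F n) (f n)"
    "\<And>n v. v \<in> F n \<Longrightarrow> f (Suc n) v = f n v"
    by blast
  define c where "c v = f (Suc (to_nat v)) v" for v
  have stable: "f n v = c v" if "v \<in> F n" for n v
  proof -
    have "Suc (to_nat v) \<le> n" using that by (auto simp: F_def)
    then show ?thesis
      by (induction rule: dec_induct) (auto simp: c_def F_def f(2))
  qed
  have "holds M c \<psi>" if "\<psi> \<in> \<Gamma>" for \<psi>
  proof -
    have "finite (to_nat ` (Inl -` fv \<psi> :: 'v set))"
      by (intro finite_imageI finite_vimageI finite_fv) auto
    then obtain n where "\<forall>k \<in> to_nat ` (Inl -` fv \<psi> :: 'v set). k < n"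
      using finite_nat_set_iff_bounded by auto
    then have n: "Inl -` fv \<psi> \<subseteq> F n" by (auto simp: F_def)
    have "{\<psi>} \<subseteq> \<Gamma>" "finite {\<psi>}" using that by auto
    then obtain c' where c': "\<forall>v\<in>F n. c' v = f n v" "holds M c' \<psi>"
      using f(1)[of n] unfolding finitely_satisfiable_at_def by blast
    have "sat M (case_sum c' id) [] \<psi> \<longleftrightarrow> sat M (case_sum c id) [] \<psi>"
      by (rule sat_cong) (use n c'(1) stable in \<open>auto split: sum.splits\<close>)
    then show ?thesis using c'(2) by (simp add: holds_def)
  qed
  then show ?thesis by (auto simp: realisations_def)
qed

section \<open>Stretching an indiscernible sequence to an array\<close>

text \<open>
  Every finite part of the lexicographic order on pairs embeds into the natural numbers: number the
  entries of a table with \<open>N\<close> columns row by row.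
\<close>

lemma row_major_strict_mono:
  "strict_mono_on {p. snd p < N} (\<lambda>(i, j). i * N + j :: nat)"
proof (rule strict_mono_onI, simp only: mem_Collect_eq)
  fix p q :: "nat \<times> nat" assume *: "snd p < N" "snd q < N" "p < q"
  obtain i j i' j' where pq: "p = (i, j)" "q = (i', j')" by fastforce
  show "(case p of (i, j) \<Rightarrow> i * N + j) < (case q of (i, j) \<Rightarrow> i * N + j)"
  proof (cases "i = i'")
    case True
    then show ?thesis using * pq by simp
  next
    case False
    then have "Suc i * N \<le> i' * N" using * pq by (intro mult_le_mono1) auto
    then show ?thesis using * pq by simp
  qed
qed

text \<open>
  Indices may be moved up along an order preserving map \<open>h\<close> provided that gaps do not shrink. The gap
  condition is what allows the finite map \<open>f p \<mapsto> h p\<close> to be extended to a strictly increasing map \<open>t\<close> of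
  all natural numbers, as indiscernibility asks for.
\<close>

lemma indiscernible_shift:
  fixes M :: "('f, 'r, 'm) str" and a :: "nat \<Rightarrow> 'k \<Rightarrow> 'm"
  assumes ind: "indiscernible L M {} UNIV a" and \<chi>: "\<chi> \<in> formulas L"
    and le: "\<And>p. p \<in> fst ` fv \<chi> \<Longrightarrow> f p \<le> (h p :: nat)"
    and gap: "\<And>p q. p \<in> fst ` fv \<chi> \<Longrightarrow> q \<in> fst ` fv \<chi> \<Longrightarrow> f q \<le> f p \<Longrightarrow> h q + (f p - f q) \<le> h p"
  shows "sat M (\<lambda>(p, k). a (f p) k) [] \<chi> \<longleftrightarrow> sat M (\<lambda>(p, k). a (h p) k) [] \<chi>"
proof -
  define S where "S = fst ` fv \<chi>"
  \<comment> \<open>\<open>t n\<close> is the largest value forced by the prescribed values at or below \<open>n\<close>; advancing \<open>n\<close> by one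
     raises each candidate by one, so \<open>t\<close> is strictly increasing.\<close>
  define V where "V n = insert n ((\<lambda>p. h p + (n - f p)) ` {p \<in> S. f p \<le> n})" for n
  define t where "t n = Max (V n)" for n
  have finV: "finite (V n)" "V n \<noteq> {}" for n
    by (auto simp: V_def S_def finite_fv)
  have "t n < t (Suc n)" for n
  proof -
    have "t n \<in> V n" unfolding t_def by (rule Max_in[OF finV])
    then have "Suc (t n) \<in> V (Suc n)"
      unfolding V_def by (auto simp: Suc_diff_le image_iff intro: le_SucI)
    then show ?thesis
      unfolding t_def by (metis Max_ge Suc_le_lessD finV(1) t_def)
  qed
  then have "strict_mono t" by (simp add: strict_mono_Suc_iff)
  have t_f: "t (f p) = h p" if "p \<in> S" for p
    unfolding t_def
  proof (rule Max_eqI[OF finV(1)])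
    show "h p \<in> V (f p)" using that by (auto simp: V_def image_iff intro!: bexI[of _ p])
    fix y assume "y \<in> V (f p)"
    then show "y \<le> h p"
      using that le gap unfolding V_def S_def by fastforce
  qed
  define \<psi> :: "('f, 'r, (nat \<times> 'k) + 'm) fm" where "\<psi> = map_fm (\<lambda>(p, k). Inl (f p, k)) \<chi>"
  have "Inr -` fv \<psi> = {}" by (auto simp: \<psi>_def fm.set_map)
  then have "\<psi> \<in> formulas_over L {}"
    using \<chi> by (simp add: formulas_over_def \<psi>_def map_in_formulas)
  moreover have "strict_mono (id :: nat \<Rightarrow> nat)" by (simp add: strict_mono_def)
  ultimately have "holds M (\<lambda>(l, k). a (id l) k) \<psi> \<longleftrightarrow> holds M (\<lambda>(l, k). a (t l) k) \<psi>"
    using ind \<open>strict_mono t\<close> unfolding indiscernible_def by (metis UNIV_Times_UNIV subset_UNIV)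
  moreover have "holds M (\<lambda>(l, k). a (id l) k) \<psi> \<longleftrightarrow> sat M (\<lambda>(p, k). a (f p) k) [] \<chi>"
    unfolding \<psi>_def holds_map by (rule sat_cong) (auto split: prod.splits)
  moreover have "holds M (\<lambda>(l, k). a (t l) k) \<psi> \<longleftrightarrow> sat M (\<lambda>(p, k). a (h p) k) [] \<chi>"
    unfolding \<psi>_def holds_map
    by (rule sat_cong) (use t_f in \<open>force simp: S_def split: prod.splits\<close>)
  ultimately show ?thesis by blast
qed

text \<open>
  The truth of a formula in an indiscernible sequence depends on the order of the indices only. The
  variables carry labels \<open>p\<close> of any type, and \<open>f\<close>, \<open>g\<close> assign positions in the sequence to the labels.
\<close>

lemma indiscernible_same_order:
  fixes M :: "('f, 'r, 'm) str" and a :: "nat \<Rightarrow> 'k \<Rightarrow> 'm"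
  assumes ind: "indiscernible L M {} UNIV a" and \<chi>: "\<chi> \<in> formulas L"
    and order: "\<And>p q. p \<in> fst ` fv \<chi> \<Longrightarrow> q \<in> fst ` fv \<chi> \<Longrightarrow> f p < f q \<longleftrightarrow> g p < (g q :: nat)"
  shows "sat M (\<lambda>(p, k). a (f p) k) [] \<chi> \<longleftrightarrow> sat M (\<lambda>(p, k). a (g p) k) [] \<chi>"
proof -
  define S where "S = fst ` fv \<chi>"
  have "finite (f ` S \<union> g ` S)" by (simp add: S_def finite_fv)
  then obtain D where "\<forall>x \<in> f ` S \<union> g ` S. x \<le> D"
    by (meson finite_nat_set_iff_bounded_le)
  then have D: "f p \<le> D" "g p \<le> D" if "p \<in> S" for p using that by auto
  \<comment> \<open>Common target of \<open>f\<close> and \<open>g\<close>: both can be moved up to \<open>h\<close>, whose gaps are at least \<open>D\<close>.\<close>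
  define h where "h p = D * f p + D" for p
  have step: "h q + D \<le> h p" if "f q < f p" for p q
  proof -
    have "D * f q + D = D * Suc (f q)" by simp
    also have "\<dots> \<le> D * f p" using that by (intro mult_le_mono2) simp
    finally show ?thesis by (simp add: h_def)
  qed
  have "sat M (\<lambda>(p, k). a (f p) k) [] \<chi> \<longleftrightarrow> sat M (\<lambda>(p, k). a (h p) k) [] \<chi>"
  proof (rule indiscernible_shift[OF ind \<chi>], unfold S_def[symmetric])
    fix p q assume "p \<in> S" "q \<in> S" "f q \<le> f p"
    then show "h q + (f p - f q) \<le> h p"
      using D(1)[of p] step[of q p] by (cases "f q = f p") (auto simp: h_def)
  qed (use D in \<open>simp add: h_def trans_le_add2\<close>)
  moreover have "sat M (\<lambda>(p, k). a (g p) k) [] \<chi> \<longleftrightarrow> sat M (\<lambda>(p, k). a (h p) k) [] \<chi>"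
  proof (rule indiscernible_shift[OF ind \<chi>], unfold S_def[symmetric])
    fix p q assume *: "p \<in> S" "q \<in> S" "g q \<le> g p"
    then consider "g q < g p" "f q < f p" | "g q = g p" "f q = f p"
      using order unfolding S_def by (metis le_neq_implies_less linorder_neqE_nat nat_less_le)
    then show "h q + (g p - g q) \<le> h p"
      using D(2)[OF *(1)] step[of q p] by cases (auto simp: h_def)
  qed (use D in \<open>simp add: h_def trans_le_add2\<close>)
  ultimately show ?thesis by blast
qed

text \<open>
  The formulas that hold in the given sequence at all order preserving positions form a finitely
  satisfiable type in the entries of the array. It is complete, because by indiscernibility the choice of
  the positions is irrelevant, so a realisation agrees with the sequence on every formula.
\<close>

lemma lexicographic_array:
  fixes M :: "('f, 'r, 'm) str" and a :: "nat \<Rightarrow> 'k::countable \<Rightarrow> 'm"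
  assumes sat: "saturated L M" and unc: "small M (UNIV :: nat set)"
    and ind: "indiscernible L M {} UNIV a"
  obtains b :: "nat \<Rightarrow> nat \<Rightarrow> 'k \<Rightarrow> 'm" where
    "\<And>(\<chi> :: ('f, 'r, (nat \<times> nat) \<times> 'k) fm) f.
       \<lbrakk>\<chi> \<in> formulas L; strict_mono_on (fst ` fv \<chi>) f\<rbrakk> \<Longrightarrow>
       sat M (\<lambda>((i, j), k). b i j k) [] \<chi> \<longleftrightarrow> sat M (\<lambda>(p, k). a (f p) k) [] \<chi>"
proof -
  define \<Gamma> where "\<Gamma> = {\<chi> :: ('f, 'r, (nat \<times> nat) \<times> 'k) fm. \<chi> \<in> formulas L \<and>
     (\<forall>f. strict_mono_on (fst ` fv \<chi>) f \<longrightarrow> sat M (\<lambda>(p, k). a (f p) k) [] \<chi>)}"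
  have inj: "holds M c (map_fm Inl \<chi>) \<longleftrightarrow> sat M c [] \<chi>" for c and \<chi> :: "('f, 'r, (nat \<times> nat) \<times> 'k) fm"
    unfolding holds_map by (rule sat_cong) simp
  have "map_fm Inl ` \<Gamma> \<subseteq> formulas_over L {}"
    by (auto simp: \<Gamma>_def formulas_over_def map_in_formulas fm.set_map)
  moreover have "consistent M (map_fm Inl ` \<Gamma>)"
    unfolding consistent_def
  proof (intro allI impI)
    fix D :: "('f, 'r, (nat \<times> nat) \<times> 'k + 'm) fm set"
    assume "D \<subseteq> map_fm Inl ` \<Gamma>" "finite D"
    then obtain \<Delta> where \<Delta>: "\<Delta> \<subseteq> \<Gamma>" "finite \<Delta>" "D = map_fm Inl ` \<Delta>"
      by (meson finite_subset_image)
    have "finite (\<Union>\<chi>\<in>\<Delta>. snd ` fst ` fv \<chi>)"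
      using \<Delta>(2) by (auto simp: finite_fv)
    then obtain N where N: "\<forall>j \<in> (\<Union>\<chi>\<in>\<Delta>. snd ` fst ` fv \<chi>). j < N"
      by (meson finite_nat_set_iff_bounded)
    define f :: "nat \<times> nat \<Rightarrow> nat" where "f = (\<lambda>(i, j). i * N + j)"
    have "strict_mono_on (fst ` fv \<chi>) f" if "\<chi> \<in> \<Delta>" for \<chi>
      unfolding f_def
      by (rule monotone_on_subset[OF row_major_strict_mono]) (use N that in blast)
    then have "(\<lambda>(p, k). a (f p) k) \<in> realisations M D"
      using \<Delta> by (auto simp: realisations_def inj \<Gamma>_def)
    then show "realisations M D \<noteq> {}" by blast
  qed
  moreover have "small M {}" using unc by (rule small_finite) simp
  ultimately obtain c where c: "c \<in> realisations M (map_fm Inl ` \<Gamma>)"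
    using saturated_realises_countable_types[OF sat unc] by blast
  have c\<Gamma>: "sat M c [] \<chi>" if "\<chi> \<in> \<Gamma>" for \<chi>
    using c that by (auto simp: realisations_def inj)
  show ?thesis
  proof (rule that[of "\<lambda>i j k. c ((i, j), k)"])
    fix \<chi> :: "('f, 'r, (nat \<times> nat) \<times> 'k) fm" and f :: "nat \<times> nat \<Rightarrow> nat"
    assume \<chi>: "\<chi> \<in> formulas L" "strict_mono_on (fst ` fv \<chi>) f"
    have same: "sat M (\<lambda>(p, k). a (g p) k) [] \<chi> \<longleftrightarrow> sat M (\<lambda>(p, k). a (f p) k) [] \<chi>"
      if "strict_mono_on (fst ` fv \<chi>) g" for g
      using indiscernible_same_order[OF ind \<chi>(1)] strict_mono_on_less[OF that] strict_mono_on_less[OF \<chi>(2)]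
      by blast
    have "(if sat M (\<lambda>(p, k). a (f p) k) [] \<chi> then \<chi> else Neg \<chi>) \<in> \<Gamma>"
      using \<chi>(1) same by (auto simp: \<Gamma>_def formulas_def)
    then have "sat M c [] \<chi> \<longleftrightarrow> sat M (\<lambda>(p, k). a (f p) k) [] \<chi>"
      by (auto dest!: c\<Gamma> split: if_splits)
    moreover have "(\<lambda>((i, j), k). c ((i, j), k)) = c" by auto
    ultimately show "sat M (\<lambda>((i, j), k). c ((i, j), k)) [] \<chi> \<longleftrightarrow> sat M (\<lambda>(p, k). a (f p) k) [] \<chi>"
      by simp
  qed
qed

text \<open>
  Moving the entries of row \<open>i\<^sub>0\<close> by a strictly increasing map, with all other rows fixed, does not change
  the lexicographic order of the entries. Hence the truth of a formula, computed in the original sequence,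
  does not change either.
\<close>

lemma lexicographic_array_indiscernible:
  fixes M :: "('f, 'r, 'm) str" and a :: "nat \<Rightarrow> 'k \<Rightarrow> 'm"
  assumes ind: "indiscernible L M {} UNIV a"
    and b: "\<And>(\<chi> :: ('f, 'r, (nat \<times> nat) \<times> 'k) fm) f.
       \<lbrakk>\<chi> \<in> formulas L; strict_mono_on (fst ` fv \<chi>) f\<rbrakk> \<Longrightarrow>
       sat M (\<lambda>((i, j), k). b i j k) [] \<chi> \<longleftrightarrow> sat M (\<lambda>(p, k). a (f p) k) [] \<chi>"
  shows "indiscernible_array L M {} K b"
  unfolding indiscernible_array_def indiscernible_def
proof (intro allI impI, elim conjE)
  fix i0 and \<psi> :: "('f, 'r, (nat \<times> 'k) + 'm) fm" and s t :: "nat \<Rightarrow> nat"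
  let ?A = "{} \<union> {b i j k | i j k. i \<noteq> i0 \<and> k \<in> K i}"
  assume \<psi>: "\<psi> \<in> formulas_over L ?A" and st: "strict_mono s" "strict_mono t"
  have "\<forall>m \<in> Inr -` fv \<psi>. \<exists>i j k. i \<noteq> i0 \<and> m = b i j k"
    using \<psi> unfolding formulas_over_def by blast
  then obtain I J k where I: "\<And>m. Inr m \<in> fv \<psi> \<Longrightarrow> I m \<noteq> i0 \<and> m = b (I m) (J m) (k m)"
    by (metis vimageI)
  then have I': "Inr m \<in> fv \<psi> \<Longrightarrow> i0 \<noteq> I m" for m by blast
  \<comment> \<open>The parameters come from other rows; turn them back into variables, so that \<open>X s\<close> is a formula
     about the array without parameters.\<close>
  define place where "place s = case_sum (\<lambda>(l, k). ((i0, s l), k)) (\<lambda>m. ((I m, J m), k m))" for s :: "nat \<Rightarrow> nat"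
  define X where "X s = map_fm (place s) \<psi>" for s
  have X_formula: "X s \<in> formulas L" for s
    using \<psi> by (simp add: X_def map_in_formulas formulas_over_def)
  have X_holds: "holds M (\<lambda>(l, k). b i0 (s l) k) \<psi> \<longleftrightarrow> sat M (\<lambda>((i, j), k). b i j k) [] (X s)" for s
    unfolding X_def sat_map holds_def
    by (rule sat_cong) (auto simp: place_def I split: sum.splits)
  define N where "N = Suc (Max (insert 0 (snd ` fst ` fv (X s) \<union> snd ` fst ` fv (X t))))"
  have N: "j < N" if "((i, j), k) \<in> fv (X s) \<union> fv (X t)" for i j k
  proof -
    have "j \<in> snd ` fst ` fv (X s) \<union> snd ` fst ` fv (X t)" using that by force
    then show ?thesis unfolding N_def by (intro le_imp_less_Suc Max_ge) (auto simp: finite_fv)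
  qed
  define f where "f = (\<lambda>(i, j). i * N + j)"
  have f: "strict_mono_on {p. snd p < N} f"
    unfolding f_def by (rule row_major_strict_mono)
  have "strict_mono_on (fst ` fv (X t)) f" "strict_mono_on (fst ` fv (X s)) f"
    by (rule monotone_on_subset[OF f], use N in force)+
  then have "sat M (\<lambda>((i, j), k). b i j k) [] (X s) \<longleftrightarrow> sat M (\<lambda>(p, k). a (f p) k) [] (X s)"
    "sat M (\<lambda>((i, j), k). b i j k) [] (X t) \<longleftrightarrow> sat M (\<lambda>(p, k). a (f p) k) [] (X t)"
    using b X_formula by blast+
  moreover have "sat M (\<lambda>(p, k). a (f p) k) [] (X s) \<longleftrightarrow> sat M (\<lambda>(p, k). a (f p) k) [] (X t)"
  proof -
    \<comment> \<open>Both \<open>X s\<close> and \<open>X t\<close> are renamings of \<open>\<chi>\<close>; \<open>at u p\<close> is the position of the label \<open>p\<close> of \<open>\<chi>\<close>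
       after row \<open>i0\<close> has been moved by \<open>u\<close>.\<close>
    define \<chi> where "\<chi> = map_fm (place id) \<psi>"
    define at where "at s = (\<lambda>(i, j). f (if i = i0 then (i0, s j) else (i, j)))" for s :: "nat \<Rightarrow> nat"
    have "sat M (\<lambda>(p, k). a (f p) k) [] (X s) \<longleftrightarrow> sat M (\<lambda>(p, k). a (at s p) k) [] \<chi>" for s
      unfolding X_def \<chi>_def sat_map
      by (rule sat_cong) (auto simp: place_def at_def I I' split: sum.splits)
    moreover have "sat M (\<lambda>(p, k). a (at s p) k) [] \<chi> \<longleftrightarrow> sat M (\<lambda>(p, k). a (at t p) k) [] \<chi>"
    proof (rule indiscernible_same_order[OF ind])
      show "\<chi> \<in> formulas L" using \<psi> by (simp add: \<chi>_def map_in_formulas formulas_over_def)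
      \<comment> \<open>The numbering \<open>f\<close> is order preserving only on the first \<open>N\<close> columns.\<close>
      define bounded where
        "bounded u p \<longleftrightarrow> snd (if fst p = i0 then (i0, u (snd p)) else p) < N" for u :: "nat \<Rightarrow> nat" and p
      have less: "at u p < at u q \<longleftrightarrow> p < q" if "strict_mono u" "bounded u p" "bounded u q" for u p q
      proof -
        let ?r = "\<lambda>p. if fst p = i0 then (i0, u (snd p)) else p"
        have "at u p = f (?r p)" for p
          by (cases p) (auto simp: at_def)
        moreover have "f (?r p) < f (?r q) \<longleftrightarrow> ?r p < ?r q"
          using that(2,3) unfolding bounded_def by (intro strict_mono_on_less[OF f]) auto
        moreover have "?r p < ?r q \<longleftrightarrow> p < q"
          using strict_mono_less[OF that(1)] by (cases p; cases q) auto
        ultimately show ?thesis by simp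
      qed
      have bdd: "bounded u p" if p: "p \<in> fst ` fv \<chi>" and u: "u = s \<or> u = t" for u p
      proof -
        obtain x where x: "x \<in> fv \<psi>" "p = fst (place id x)"
          using p unfolding \<chi>_def fm.set_map by blast
        have "place u x \<in> fv (X s) \<union> fv (X t)"
          using x(1) u by (auto simp: X_def fm.set_map)
        then have "snd (fst (place u x)) < N"
          using N by (metis prod.collapse)
        then show ?thesis
          using x by (auto simp: place_def bounded_def I I' split: sum.splits)
      qed
      show "at s p < at s q \<longleftrightarrow> at t p < at t q" if "p \<in> fst ` fv \<chi>" "q \<in> fst ` fv \<chi>" for p q
        using that by (simp add: less[OF st(1)] less[OF st(2)] bdd)
    qed
    ultimately show ?thesis by blast
  qed
  ultimately show "holds M (\<lambda>(l, k). b i0 (s l) k) \<psi> \<longleftrightarrow> holds M (\<lambda>(l, k). b i0 (t l) k) \<psi>"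
    using X_holds by blast
qed

section \<open>Alternation along an indiscernible sequence\<close>

text \<open>
  If formulas \<open>\<phi>\<^sub>i\<close> can be made to switch from true at \<open>a\<^sub>2\<^sub>i\<close> to false at \<open>a\<^sub>2\<^sub>i\<^sub>+\<^sub>1\<close> for arbitrarily many \<open>i\<close> at once,
  then in the stretched array they can be made to switch between the first two columns, since
  \<open>a\<^sub>0, a\<^sub>1, a\<^sub>2, \<dots>\<close> and \<open>b\<^sub>0\<^sub>0, b\<^sub>0\<^sub>1, b\<^sub>1\<^sub>0, b\<^sub>1\<^sub>1, \<dots>\<close> are ordered alike.

  The tuples \<open>a\<^sub>l\<close> may be long, but the \<open>\<phi>\<^sub>i\<close> use countably many of their entries altogether and each of them
  only finitely many. Restricted to these entries, and numbered, the data have the form that the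
  definition of strong dependence expects.
\<close>

lemma alternation_not_strongly_dependent:
  fixes M :: "('f, 'r, 'm) str" and a :: "nat \<Rightarrow> 'y \<Rightarrow> 'm"
    and \<phi> :: "nat \<Rightarrow> ('f, 'r, 'x::finite + 'y) fm"
  assumes sat: "saturated L M" and unc: "small M (UNIV :: nat set)"
    and ind: "indiscernible L M {} UNIV a" and \<phi>: "\<And>i. \<phi> i \<in> formulas L"
    and alt: "\<And>n. \<exists>c. \<forall>i<n. holds M c (inst (a (2 * i)) (\<phi> i)) \<and>
                                 \<not> holds M c (inst (a (2 * i + 1)) (\<phi> i))"
  shows "\<not> strongly_dependent L M"
proof -
  have fin_vars: "finite (Inr -` fv \<psi>)" for \<psi> :: "('f, 'r, 'u + 'w) fm"
    using finite_fv by (rule finite_vimageI) simp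
  define Y where "Y = (\<Union>i. Inr -` fv (\<phi> i))"
  have "countable Y"
    unfolding Y_def by (rule countable_UN) (auto intro: countable_finite fin_vars)
  define code where "code = to_nat_on Y"
  have decode: "from_nat_into Y (code y) = y" if "Inr y \<in> fv (\<phi> i)" for i y
  proof -
    have "y \<in> Y" using that by (auto simp: Y_def)
    then show ?thesis using \<open>countable Y\<close> by (simp add: code_def)
  qed
  define a' where "a' l k = a l (from_nat_into Y k)" for l k
  have ind': "indiscernible L M {} UNIV a'"
    unfolding indiscernible_def
  proof (intro allI impI, elim conjE)
    fix \<psi> :: "('f, 'r, (nat \<times> nat) + 'm) fm" and s t :: "nat \<Rightarrow> nat"
    assume \<psi>: "\<psi> \<in> formulas_over L {}" and st: "strict_mono s" "strict_mono t"
    define \<psi>' where "\<psi>' = map_fm (map_sum (\<lambda>(l, k). (l, from_nat_into Y k)) id) \<psi>"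
    have "\<psi>' \<in> formulas_over L {}"
      using \<psi> by (simp add: \<psi>'_def rename_formulas_over)
    moreover have "holds M (\<lambda>(l, k). a (s l) k) \<psi>' \<longleftrightarrow> holds M (\<lambda>(l, k). a' (s l) k) \<psi>" for s
      unfolding \<psi>'_def holds_map unfolding holds_def
      by (rule sat_cong) (auto simp: a'_def split: sum.splits)
    ultimately show "holds M (\<lambda>(l, k). a' (s l) k) \<psi> \<longleftrightarrow> holds M (\<lambda>(l, k). a' (t l) k) \<psi>"
      using ind st unfolding indiscernible_def by (metis UNIV_Times_UNIV subset_UNIV)
  qed
  obtain b where b: "\<And>(\<chi> :: ('f, 'r, (nat \<times> nat) \<times> nat) fm) f.
       \<lbrakk>\<chi> \<in> formulas L; strict_mono_on (fst ` fv \<chi>) f\<rbrakk> \<Longrightarrow>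
       sat M (\<lambda>((i, j), k). b i j k) [] \<chi> \<longleftrightarrow> sat M (\<lambda>(p, k). a' (f p) k) [] \<chi>"
    using lexicographic_array[OF sat unc ind'] by blast
  have "finite (UNIV :: 'x set)" by simp
  then obtain xs and n :: nat where xs: "bij_betw xs (UNIV :: 'x set) {..<n}"
    using ex_bij_betw_finite_nat atLeast0LessThan by metis
  define \<phi>' :: "nat \<Rightarrow> ('f, 'r, nat + nat) fm" where "\<phi>' i = map_fm (map_sum xs code) (\<phi> i)" for i
  have \<phi>': "\<phi>' i \<in> formulas L" for i
    using \<phi> by (simp add: \<phi>'_def map_in_formulas)
  have "\<exists>m. \<forall>k \<in> Inr -` fv (\<phi>' i). k < m" for i
    using fin_vars[of "\<phi>' i"] unfolding finite_nat_set_iff_bounded .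
  then obtain m where m: "\<And>i k. Inr k \<in> fv (\<phi>' i) \<Longrightarrow> k < m i" 
    by (metis vimageI)
  have "fv (\<phi>' i) \<subseteq> {..<n} <+> {..<m i}" for i
  proof
    fix v assume v: "v \<in> fv (\<phi>' i)"
    show "v \<in> {..<n} <+> {..<m i}"
    proof (cases v)
      case (Inl l)
      with v have "Inl l \<in> map_sum xs code ` fv (\<phi> i)" by (simp add: \<phi>'_def fm.set_map)
      then obtain z where "map_sum xs code z = Inl l" by (metis imageE)
      then have "l \<in> range xs" by (cases z) auto
      then show ?thesis using xs Inl by (auto simp: bij_betw_def)
    next
      case (Inr k)
      then show ?thesis using v m by auto
    qed
  qed
  moreover have "indiscernible_array L M {} (\<lambda>i. {..<m i}) b"
    by (rule lexicographic_array_indiscernible[OF ind' b])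
  moreover have "consistent M (range (\<lambda>i. Conj (inst (b i 0) (\<phi>' i)) (Neg (inst (b i 1) (\<phi>' i)))))"
    unfolding consistent_def
  proof (intro allI impI)
    fix D assume "D \<subseteq> range (\<lambda>i. Conj (inst (b i 0) (\<phi>' i)) (Neg (inst (b i 1) (\<phi>' i))))" "finite D"
    then obtain J where J: "finite J" "D = (\<lambda>i. Conj (inst (b i 0) (\<phi>' i)) (Neg (inst (b i 1) (\<phi>' i)))) ` J"
      by (meson finite_subset_image)
    obtain N where N: "\<And>i. i \<in> J \<Longrightarrow> i < N"
      using J(1)[unfolded finite_nat_set_iff_bounded] by blast
    \<comment> \<open>\<open>\<phi>\<^sub>i(x, y)\<close> with \<open>y\<close> the entry in row \<open>i\<close> and column \<open>j\<close>.\<close>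
    define at where "at i j = map_fm (map_sum id (\<lambda>k. ((i, j), k))) (\<phi>' i)" for i j :: nat
    define \<Delta> where "\<Delta> = (\<lambda>i. at i 0) ` J \<union> (\<lambda>i. Neg (at i 1)) ` J"
    have at: "at i j \<in> formulas L" for i j
      using \<phi>' by (simp add: at_def map_in_formulas)
    then have \<Delta>: "finite \<Delta>" "\<Delta> \<subseteq> formulas L"
      using J(1) by (auto simp: \<Delta>_def formulas_def)
    then obtain \<kappa> where \<kappa>: "\<kappa> \<in> formulas L" "fv \<kappa> = \<Union> (fv ` \<Delta>)"
      "\<And>e. sat M e [] \<kappa> \<longleftrightarrow> (\<forall>\<psi>\<in>\<Delta>. sat M e [] \<psi>)"
      using finite_conjunction[OF \<Delta>] by metis
    \<comment> \<open>Only the variables \<open>x\<close> are quantified, so \<open>\<theta>\<close> speaks about the array alone.\<close>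
    define S where "S = fv \<kappa> \<inter> range Inl"
    have "finite S" by (simp add: S_def finite_fv)
    then obtain \<theta> where \<theta>: "\<theta> \<in> formulas L" "fv \<theta> = fv \<kappa> - S"
      "\<And>e. sat M e [] \<theta> \<longleftrightarrow> (\<exists>e'. (\<forall>v. v \<notin> S \<longrightarrow> e' v = e v) \<and> sat M e' [] \<kappa>)"
      using existential_closure[OF _ \<kappa>(1)] by metis
    have at_sat: "sat M e [] (at i j) \<longleftrightarrow> sat M (case_sum (e \<circ> Inl) (\<lambda>k. e (Inr ((i, j), k)))) [] (\<phi>' i)"
      for e i j unfolding at_def sat_map by (rule sat_cong) (auto split: sum.splits)
    have \<Delta>_sat: "(\<forall>\<psi>\<in>\<Delta>. sat M e [] \<psi>) \<longleftrightarrow>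
        (\<forall>i\<in>J. sat M e [] (at i 0) \<and> \<not> sat M e [] (at i 1))" for e
      by (simp add: \<Delta>_def ball_Un ball_conj_distrib)
    have \<theta>_sat: "sat M e [] \<theta> \<longleftrightarrow> (\<exists>c. \<forall>i\<in>J.
        sat M (case_sum c (\<lambda>k. e (Inr ((i, 0), k)))) [] (\<phi>' i) \<and>
        \<not> sat M (case_sum c (\<lambda>k. e (Inr ((i, 1), k)))) [] (\<phi>' i))" (is "_ \<longleftrightarrow> ?R") for e
    proof
      assume "sat M e [] \<theta>"
      then obtain e' where e': "\<forall>v. v \<notin> S \<longrightarrow> e' v = e v" "\<forall>\<psi>\<in>\<Delta>. sat M e' [] \<psi>"
        unfolding \<theta>(3) \<kappa>(3) by blast
      have "e' (Inr p) = e (Inr p)" for p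
        using e'(1) by (auto simp: S_def)
      then show ?R
        using e'(2) unfolding \<Delta>_sat at_sat by (intro exI[of _ "e' \<circ> Inl"]) simp
    next
      assume ?R
      then obtain c where c: "\<forall>i\<in>J.
        sat M (case_sum c (\<lambda>k. e (Inr ((i, 0), k)))) [] (\<phi>' i) \<and>
        \<not> sat M (case_sum c (\<lambda>k. e (Inr ((i, 1), k)))) [] (\<phi>' i)" by blast
      define e' where "e' = (\<lambda>v. if v \<in> S then case_sum c (e \<circ> Inr) v else e v)"
      have "sat M e' [] \<kappa> \<longleftrightarrow> sat M (case_sum c (e \<circ> Inr)) [] \<kappa>"
        by (rule sat_cong) (auto simp: e'_def S_def split: sum.splits)
      moreover have "case_sum c (e \<circ> Inr) \<circ> Inl = c" by auto
      then have "sat M (case_sum c (e \<circ> Inr)) [] \<kappa>"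
        using c unfolding \<kappa>(3) \<Delta>_sat at_sat by simp
      ultimately show "sat M e [] \<theta>"
        unfolding \<theta>(3) by (intro exI[of _ e']) (auto simp: e'_def)
    qed
    define \<chi> where "\<chi> = map_fm projr \<theta>"
    have \<chi>_sat: "sat M e [] \<chi> \<longleftrightarrow> (\<exists>c. \<forall>i\<in>J.
        sat M (case_sum c (\<lambda>k. e ((i, 0), k))) [] (\<phi>' i) \<and>
        \<not> sat M (case_sum c (\<lambda>k. e ((i, 1), k))) [] (\<phi>' i))" for e
      unfolding \<chi>_def sat_map \<theta>_sat by simp
    \<comment> \<open>Two columns occur, and \<open>f\<close> sends them to the even and the odd positions.\<close>
    define f :: "nat \<times> nat \<Rightarrow> nat" where "f = (\<lambda>(i, j). i * 2 + j)"
    have "fst ` fv \<chi> \<subseteq> {p. snd p < 2}"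
    proof
      fix p assume "p \<in> fst ` fv \<chi>"
      then obtain v where v: "v \<in> fv \<theta>" "p = fst (projr v)"
        unfolding \<chi>_def fm.set_map by blast
      then have "v \<in> fv \<kappa>" "v \<notin> range Inl" by (auto simp: \<theta>(2) S_def)
      then obtain q i j where "v = Inr q" "j < 2" "v \<in> fv (at i j)"
        unfolding \<kappa>(2) \<Delta>_def by (cases v) fastforce+
      then show "p \<in> {p. snd p < 2}"
        using v(2) unfolding at_def fm.set_map
        by (auto simp: map_sum_def split: sum.splits)
    qed
    then have "strict_mono_on (fst ` fv \<chi>) f"
      unfolding f_def by (rule monotone_on_subset[OF row_major_strict_mono])
    moreover have "\<chi> \<in> formulas L"
      using \<theta>(1) by (simp add: \<chi>_def map_in_formulas)
    ultimately have "sat M (\<lambda>((i, j), k). b i j k) [] \<chi> \<longleftrightarrow> sat M (\<lambda>(p, k). a' (f p) k) [] \<chi>"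
      by (intro b)
    moreover have "sat M (\<lambda>(p, k). a' (f p) k) [] \<chi>"
    proof -
      obtain c where c: "\<forall>i<N. holds M c (inst (a (2 * i)) (\<phi> i)) \<and>
                                 \<not> holds M c (inst (a (2 * i + 1)) (\<phi> i))"
        using alt by blast
      have "sat M (case_sum (c \<circ> inv_into UNIV xs) (a' l)) [] (\<phi>' i) \<longleftrightarrow> holds M c (inst (a l) (\<phi> i))" for l i
        unfolding \<phi>'_def sat_map holds_inst
        by (rule sat_cong) (use xs decode in \<open>auto simp: a'_def bij_betw_def split: sum.splits\<close>)
      then show ?thesis
        unfolding \<chi>_sat using c N
        by (intro exI[of _ "c \<circ> inv_into UNIV xs"]) (auto simp: f_def mult.commute)
    qed
    ultimately have "sat M (\<lambda>((i, j), k). b i j k) [] \<chi>" by blast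
    then obtain c where "\<forall>i\<in>J. sat M (case_sum c (b i 0)) [] (\<phi>' i) \<and>
        \<not> sat M (case_sum c (b i 1)) [] (\<phi>' i)"
      unfolding \<chi>_sat by auto
    then have "c \<in> realisations M D"
      unfolding J(2) realisations_def
      by (auto simp: holds_inst[symmetric]) (auto simp: holds_def)
    then show "realisations M D \<noteq> {}" by blast
  qed
  ultimately show ?thesis
    using \<phi>' unfolding strongly_dependent_def by blast
qed

section \<open>Type definable groups\<close>

text \<open>
  Let \<open>H\<close> be the subgroup defined by \<open>p\<close>. For \<open>u, c, v \<in> H\<close> the product \<open>ucv\<close> is in \<open>H\<close> and satisfies \<open>\<psi>\<close>. By
  compactness, for group elements \<open>c\<close> this already follows from \<open>u, v \<in> H\<close> and finitely many of the
  conditions that \<open>p\<close> puts on \<open>c\<close>; \<open>\<phi>\<close> is the conjunction of these. The conclusion is for \<open>ucv\<close>, with factors on both sides, because the group need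
  not be commutative.

  As \<open>\<phi>\<close> is a conjunction of members of \<open>p\<close>, it also holds throughout the set that \<open>p\<close> defines with any
  other parameters.
\<close>

lemma type_definable_subgroup_separation:
  fixes M :: "('f, 'r, 'm) str" and G :: "('x::finite \<Rightarrow> 'm) monoid"
    and p :: "('f, 'r, 'x + 'y) fm set" and a :: "'y \<Rightarrow> 'm"
  assumes sat: "saturated L M" and unc: "small M (UNIV :: nat set)"
    and G: "type_definable_group L M G" and y: "small M (UNIV :: 'y set)"
    and p: "p \<subseteq> formulas L" and H: "subgroup (realisations M (inst a ` p)) G"
    and \<psi>: "\<psi> \<in> p"
  obtains \<phi> where "\<phi> \<in> formulas L"
    "\<And>(b :: 'y \<Rightarrow> 'm) c. c \<in> realisations M (inst b ` p) \<Longrightarrow> holds M c (inst b \<phi>)"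
    "\<And>u c v. \<lbrakk>u \<in> realisations M (inst a ` p); v \<in> realisations M (inst a ` p);
       c \<in> carrier G; holds M c (inst a \<phi>)\<rbrakk> \<Longrightarrow> holds M (u \<otimes>\<^bsub>G\<^esub> c \<otimes>\<^bsub>G\<^esub> v) (inst a \<psi>)"
proof -
  interpret group G using G by (simp add: type_definable_group_def)
  obtain B and \<Sigma> :: "('f, 'r, 'x + 'm) fm set" and \<nu> where
    B: "small M B" "\<Sigma> \<subseteq> formulas_over L B" "\<nu> \<in> formulas_over L B"
    and carrier: "carrier G = realisations M \<Sigma>"
    and \<nu>: "\<And>x y z. \<lbrakk>x \<in> carrier G; y \<in> carrier G; z \<in> carrier G\<rbrakk> \<Longrightarrow>
           holds M (case_sum x (case_sum y z)) \<nu> \<longleftrightarrow> x \<otimes>\<^bsub>G\<^esub> y = z"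
    using G unfolding type_definable_group_def by blast
  define H' where "H' = realisations M (inst a ` p)"
  have H'_iff: "c \<in> H' \<longleftrightarrow> (\<forall>\<phi>\<in>p. holds M c (inst a \<phi>))" for c
    by (auto simp: H'_def realisations_def)
  have H'G: "c \<in> carrier G" if "c \<in> H'" for c
    using that subgroup.subset[OF H] by (auto simp: H'_def)
  have "\<exists>F. finite F \<and> F \<subseteq> p \<and> (\<forall>u\<in>H'. \<forall>v\<in>H'. \<forall>c\<in>carrier G.
      (\<forall>\<phi>\<in>F. holds M c (inst a \<phi>)) \<longrightarrow> holds M (u \<otimes>\<^bsub>G\<^esub> c \<otimes>\<^bsub>G\<^esub> v) (inst a \<psi>))"
  proof (rule ccontr)
    assume contra: "\<nexists>F. finite F \<and> F \<subseteq> p \<and> (\<forall>u\<in>H'. \<forall>v\<in>H'. \<forall>c\<in>carrier G.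
      (\<forall>\<phi>\<in>F. holds M c (inst a \<phi>)) \<longrightarrow> holds M (u \<otimes>\<^bsub>G\<^esub> c \<otimes>\<^bsub>G\<^esub> v) (inst a \<psi>))"
    \<comment> \<open>If no finite set works, the following type is consistent. Its variables are five copies of \<open>x\<close>: for
       \<open>u\<close>, \<open>c\<close>, \<open>v\<close> and, as multiplication is given by its graph, for \<open>uc\<close> and \<open>ucv\<close>.\<close>
    define copy :: "nat \<Rightarrow> ('f, 'r, 'x + 'm) fm \<Rightarrow> ('f, 'r, (nat \<times> 'x) + 'm) fm"
      where "copy n = map_fm (map_sum (Pair n) id)" for n
    define mult :: "nat \<Rightarrow> nat \<Rightarrow> nat \<Rightarrow> ('f, 'r, (nat \<times> 'x) + 'm) fm"
      where "mult i j k = map_fm (map_sum (case_sum (Pair i) (case_sum (Pair j) (Pair k))) id) \<nu>" for i j k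
    have copy: "holds M e (copy n \<phi>) \<longleftrightarrow> holds M (\<lambda>x. e (n, x)) \<phi>" for e n \<phi>
      unfolding copy_def holds_map unfolding holds_def by (rule sat_cong) (auto split: sum.splits)
    have mult: "holds M e (mult i j k) \<longleftrightarrow>
        holds M (case_sum (\<lambda>x. e (i, x)) (case_sum (\<lambda>x. e (j, x)) (\<lambda>x. e (k, x)))) \<nu>" for e i j k
      unfolding mult_def holds_map unfolding holds_def by (rule sat_cong) (auto split: sum.splits)
    \<comment> \<open>All conditions except those on \<open>c\<close> that come from \<open>p\<close>, of which a finite set uses finitely many.\<close>
    define \<Gamma>0 where "\<Gamma>0 = copy 0 ` inst a ` p \<union> copy 2 ` inst a ` p
      \<union> copy 1 ` \<Sigma> \<union> copy 3 ` \<Sigma> \<union> copy 4 ` \<Sigma> \<union> {mult 0 1 3, mult 3 2 4, copy 4 (Neg (inst a \<psi>))}"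
    define \<Gamma> where "\<Gamma> = \<Gamma>0 \<union> copy 1 ` inst a ` p"
    have mono: "\<phi> \<in> formulas_over L (B \<union> range a)" if "\<phi> \<in> formulas_over L B" for \<phi> :: "('f, 'r, 'u + 'm) fm"
      using that by (auto simp: formulas_over_def)
    have inst_over: "inst a \<phi> \<in> formulas_over L (B \<union> range a)" if "\<phi> \<in> p" for \<phi>
    proof -
      have "Inr -` (map_sum id a ` X) \<subseteq> B \<union> range a" for X :: "('x + 'y) set"
        by (auto simp: map_sum_def split: sum.splits)
      then show ?thesis
        using that p by (auto simp only: formulas_over_def map_in_formulas fm.set_map inst_def mem_Collect_eq)
    qed
    have "Neg (inst a \<psi>) \<in> formulas_over L (B \<union> range a)"
      using inst_over[OF \<psi>] by (simp add: formulas_over_def formulas_def)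
    then have "\<Gamma> \<subseteq> formulas_over L (B \<union> range a)"
      using B(2,3) inst_over unfolding \<Gamma>_def \<Gamma>0_def copy_def mult_def
      by (auto simp only: rename_formulas_over Un_iff insert_iff empty_iff subset_eq image_iff intro: mono)
    moreover have "small M (B \<union> range a)"
      by (intro small_Un small_image unc B(1) y)
    moreover have "consistent M \<Gamma>"
      unfolding consistent_def
    proof (intro allI impI)
      fix \<Delta> assume \<Delta>: "\<Delta> \<subseteq> \<Gamma>" "finite \<Delta>"
      then have "\<Delta> - \<Gamma>0 \<subseteq> (\<lambda>\<phi>. copy 1 (inst a \<phi>)) ` p" "finite (\<Delta> - \<Gamma>0)"
        by (auto simp: \<Gamma>_def)
      then obtain F where F: "F \<subseteq> p" "finite F" "\<Delta> - \<Gamma>0 = (\<lambda>\<phi>. copy 1 (inst a \<phi>)) ` F"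
        by (meson finite_subset_image)
      then obtain u v c where uvc: "u \<in> H'" "v \<in> H'" "c \<in> carrier G"
        "\<forall>\<phi>\<in>F. holds M c (inst a \<phi>)" "\<not> holds M (u \<otimes>\<^bsub>G\<^esub> c \<otimes>\<^bsub>G\<^esub> v) (inst a \<psi>)"
        using contra by blast
      then have uv: "u \<in> carrier G" "v \<in> carrier G" using H'G by auto
      define e where "e = (\<lambda>(n, x). ([u, c, v, u \<otimes>\<^bsub>G\<^esub> c, u \<otimes>\<^bsub>G\<^esub> c \<otimes>\<^bsub>G\<^esub> v] ! n) x)"
      have e: "(\<lambda>x. e (0, x)) = u" "(\<lambda>x. e (1, x)) = c" "(\<lambda>x. e (2, x)) = v"
        "(\<lambda>x. e (3, x)) = u \<otimes>\<^bsub>G\<^esub> c" "(\<lambda>x. e (4, x)) = u \<otimes>\<^bsub>G\<^esub> c \<otimes>\<^bsub>G\<^esub> v"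
        by (auto simp: e_def numeral_eq_Suc)
      have \<Sigma>: "holds M g \<sigma>" if "\<sigma> \<in> \<Sigma>" "g \<in> carrier G" for g \<sigma>
        using that by (auto simp: carrier realisations_def)
      have "holds M e \<gamma>" if "\<gamma> \<in> \<Gamma>0" for \<gamma>
        using that uvc uv \<Sigma> unfolding \<Gamma>0_def
        by (auto simp: copy mult e e(2)[unfolded One_nat_def] \<nu> H'_iff holds_def[of _ _ "Neg _"] simp flip: holds_def)
      moreover have "holds M e \<gamma>" if "\<gamma> \<in> \<Delta> - \<Gamma>0" for \<gamma>
        using that uvc(4) unfolding F(3) by (auto simp: copy e e(2)[unfolded One_nat_def])
      ultimately show "realisations M \<Delta> \<noteq> {}"
        unfolding realisations_def by blast
    qed
    ultimately obtain e where "e \<in> realisations M \<Gamma>"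
      using saturated_realises_countable_types[OF sat unc] by blast
    then have e: "holds M e \<gamma>" if "\<gamma> \<in> \<Gamma>" for \<gamma>
      using that by (simp add: realisations_def)
    define w where "w n = (\<lambda>x. e (n, x))" for n
    have w: "w 0 \<in> H'" "w 1 \<in> H'" "w 2 \<in> H'" "w 3 \<in> carrier G" "w 4 \<in> carrier G"
      unfolding H'_iff carrier realisations_def mem_Collect_eq w_def copy[symmetric]
      by (auto intro!: e simp: \<Gamma>_def \<Gamma>0_def)
    have "holds M e (mult 0 1 3)" "holds M e (mult 3 2 4)"
      by (auto intro!: e simp: \<Gamma>_def \<Gamma>0_def)
    then have "w 0 \<otimes>\<^bsub>G\<^esub> w 1 = w 3" "w 3 \<otimes>\<^bsub>G\<^esub> w 2 = w 4"
      unfolding mult w_def[symmetric] using \<nu> w H'G by auto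
    then have "w 4 = w 0 \<otimes>\<^bsub>G\<^esub> w 1 \<otimes>\<^bsub>G\<^esub> w 2" by simp
    then have "w 4 \<in> H'"
      using w subgroup.m_closed[OF H] unfolding H'_def by simp
    then have "holds M (w 4) (inst a \<psi>)" using \<psi> H'_iff by blast
    moreover have "holds M e (copy 4 (Neg (inst a \<psi>)))"
      by (rule e) (simp add: \<Gamma>_def \<Gamma>0_def)
    ultimately show False
      unfolding copy w_def[symmetric] by (simp add: holds_def)
  qed
  then obtain F where F: "finite F" "F \<subseteq> p"
    "\<And>u v c. \<lbrakk>u \<in> H'; v \<in> H'; c \<in> carrier G; \<forall>\<phi>\<in>F. holds M c (inst a \<phi>)\<rbrakk> \<Longrightarrow>
       holds M (u \<otimes>\<^bsub>G\<^esub> c \<otimes>\<^bsub>G\<^esub> v) (inst a \<psi>)"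
    by blast
  have "F \<subseteq> formulas L" using F(2) p by blast
  then obtain \<phi> where \<phi>: "\<phi> \<in> formulas L"
    "\<And>e. sat M e [] \<phi> \<longleftrightarrow> (\<forall>\<psi>\<in>F. sat M e [] \<psi>)"
    using finite_conjunction[OF F(1)] by metis
  have inst_\<phi>: "holds M c (inst b \<phi>) \<longleftrightarrow> (\<forall>\<psi>\<in>F. holds M c (inst b \<psi>))" for b c
    by (simp add: holds_inst \<phi>(2))
  show ?thesis
  proof (rule that[OF \<phi>(1)])
    show "holds M c (inst b \<phi>)" if "c \<in> realisations M (inst b ` p)" for b c
      using that F(2) by (auto simp: inst_\<phi> realisations_def)
    show "holds M (u \<otimes>\<^bsub>G\<^esub> c \<otimes>\<^bsub>G\<^esub> v) (inst a \<psi>)"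
      if "u \<in> realisations M (inst a ` p)" "v \<in> realisations M (inst a ` p)"
         "c \<in> carrier G" "holds M c (inst a \<phi>)" for u c v
      using F(3)[of u v c] that by (simp add: H'_def inst_\<phi>)
  qed
qed

text \<open>
  The witness is \<open>c = b\<^sub>0b\<^sub>1\<dots>b\<^sub>n\<^sub>-\<^sub>1\<close>. All factors but \<open>b\<^sub>i\<close> lie in \<open>H\<^sub>i\<close>, and so do the partial products \<open>u\<close> to the
  left and \<open>v\<close> to the right of \<open>b\<^sub>i\<close>. In particular \<open>c \<notin> H\<^sub>i\<close> if \<open>b\<^sub>i \<notin> H\<^sub>i\<close>.
\<close>

lemma (in group) product_with_one_bad_factor_each:
  fixes n :: nat
  assumes H: "\<And>i. i < n \<Longrightarrow> subgroup (H i) G"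
    and b: "\<And>i. i < n \<Longrightarrow> b i \<in> carrier G"
    and bH: "\<And>i j. i < n \<Longrightarrow> j < n \<Longrightarrow> i \<noteq> j \<Longrightarrow> b i \<in> H j"
  shows "\<exists>c. (\<forall>K. subgroup K G \<longrightarrow> (\<forall>i<n. b i \<in> K) \<longrightarrow> c \<in> K) \<and>
           (\<forall>i<n. \<exists>u\<in>H i. \<exists>v\<in>H i. c = u \<otimes> b i \<otimes> v)"
  using assms
proof (induction n)
  case 0
  show ?case by (auto intro!: exI[of _ \<one>] simp: subgroup.one_closed)
next
  case (Suc n)
  have "\<exists>c. (\<forall>K. subgroup K G \<longrightarrow> (\<forall>i<n. b i \<in> K) \<longrightarrow> c \<in> K) \<and>
           (\<forall>i<n. \<exists>u\<in>H i. \<exists>v\<in>H i. c = u \<otimes> b i \<otimes> v)"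
    by (rule Suc.IH) (simp_all add: Suc.prems)
  then obtain c where c: "\<And>K. subgroup K G \<Longrightarrow> \<forall>i<n. b i \<in> K \<Longrightarrow> c \<in> K"
    "\<forall>i<n. \<exists>u\<in>H i. \<exists>v\<in>H i. c = u \<otimes> b i \<otimes> v"
    by blast
  have "\<exists>u\<in>H i. \<exists>v\<in>H i. c \<otimes> b n = u \<otimes> b i \<otimes> v" if "i < Suc n" for i
  proof (cases "i = n")
    case True
    have "c \<in> H n" using c(1)[OF Suc.prems(1)] Suc.prems(3) by simp
    moreover have "\<one> \<in> H n" using Suc.prems(1) by (simp add: subgroup.one_closed)
    moreover have "c \<otimes> b n = c \<otimes> b n \<otimes> \<one>"
      using Suc.prems(2) c(1)[OF subgroup_self] by simp
    ultimately show ?thesis using True by blast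
  next
    case False
    then have i: "i < n" using that by simp
    then obtain u v where uv: "u \<in> H i" "v \<in> H i" "c = u \<otimes> b i \<otimes> v" using c(2) by blast
    have Hi: "subgroup (H i) G" using Suc.prems(1) i by simp
    have "v \<otimes> b n \<in> H i"
      using uv(2) Suc.prems(3) i by (intro subgroup.m_closed[OF Hi]) auto
    moreover have "c \<otimes> b n = u \<otimes> b i \<otimes> (v \<otimes> b n)"
      using uv i Suc.prems(2) subgroup.mem_carrier[OF Hi] by (simp add: m_assoc)
    ultimately show ?thesis using uv(1) by blast
  qed
  moreover have "c \<otimes> b n \<in> K" if "subgroup K G" "\<forall>i<Suc n. b i \<in> K" for K
    using that c(1) by (simp add: subgroup.m_closed)
  ultimately show ?case by blast
qed

section \<open>The chain condition\<close>

text \<open>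
  The formulas \<open>\<phi> i\<close> are fixed before \<open>n\<close> is given. Then one product of \<open>n\<close> elements with odd index satisfies
  \<open>\<phi> i\<close> at \<open>a (2 * i)\<close> and violates it at \<open>a (2 * i + 1)\<close> for all \<open>i < n\<close> simultaneously.
\<close>

lemma some_subgroup_is_redundant:
  fixes M :: "('f, 'r, 'm) str" and G :: "('x::finite \<Rightarrow> 'm) monoid"
    and p :: "nat \<Rightarrow> ('f, 'r, 'x + 'y) fm set" and a :: "nat \<Rightarrow> 'y \<Rightarrow> 'm"
  assumes sat: "saturated L M" and unc: "small M (UNIV :: nat set)"
    and dep: "strongly_dependent L M"
    and G: "type_definable_group L M G" and y: "small M (UNIV :: 'y set)"
    and p: "\<And>i. p i \<subseteq> formulas L"
    and H: "\<And>i. subgroup (realisations M (inst (a i) ` p i)) G"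
    and ind: "indiscernible L M {} UNIV a"
    and pairs: "\<And>i. p (2 * i) = p (2 * i + 1)"
  shows "\<exists>i. (\<Inter>j\<in>UNIV - {i}. realisations M (inst (a j) ` p j)) =
             (\<Inter>j. realisations M (inst (a j) ` p j))"
proof (rule ccontr)
  interpret group G using G by (simp add: type_definable_group_def)
  define K where "K j = realisations M (inst (a j) ` p j)" for j
  have K: "subgroup (K j) G" for j using H by (simp add: K_def)
  assume "\<nexists>i. (\<Inter>j\<in>UNIV - {i}. realisations M (inst (a j) ` p j)) =
             (\<Inter>j. realisations M (inst (a j) ` p j))"
  then have "(\<Inter>j\<in>UNIV - {i}. K j) \<noteq> (\<Inter>j. K j)" for i
    unfolding K_def by blast
  then have "\<exists>b. (\<forall>j. j \<noteq> i \<longrightarrow> b \<in> K j) \<and> b \<notin> K i" for i by blast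
  then obtain b where b: "\<And>i j. j \<noteq> i \<Longrightarrow> b i \<in> K j" "\<And>i. b i \<notin> K i" by metis
  have bG: "b i \<in> carrier G" for i
    using b(1)[of "Suc i" i] subgroup.mem_carrier[OF K] by simp
  have "\<exists>\<psi>\<in>p i. \<not> holds M (b i) (inst (a i) \<psi>)" for i
    using b(2)[of i] by (auto simp: K_def realisations_def)
  then obtain \<psi> where \<psi>: "\<And>i. \<psi> i \<in> p i" "\<And>i. \<not> holds M (b i) (inst (a i) (\<psi> i))" by metis
  have "\<exists>\<phi>\<in>formulas L.
      (\<forall>l c. c \<in> realisations M (inst (a l) ` p (2 * i + 1)) \<longrightarrow> holds M c (inst (a l) \<phi>)) \<and>
      (\<forall>u\<in>K (2 * i + 1). \<forall>v\<in>K (2 * i + 1). \<forall>c\<in>carrier G. holds M c (inst (a (2 * i + 1)) \<phi>) \<longrightarrow>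
         holds M (u \<otimes>\<^bsub>G\<^esub> c \<otimes>\<^bsub>G\<^esub> v) (inst (a (2 * i + 1)) (\<psi> (2 * i + 1))))" for i
    by (rule type_definable_subgroup_separation[OF sat unc G y p H \<psi>(1), of "2 * i + 1"])
      (unfold K_def, blast)
  then obtain \<phi> where \<phi>: "\<And>i. \<phi> i \<in> formulas L"
    "\<And>i l c. c \<in> realisations M (inst (a l) ` p (2 * i + 1)) \<Longrightarrow> holds M c (inst (a l) (\<phi> i))"
    "\<And>i u v c. \<lbrakk>u \<in> K (2 * i + 1); v \<in> K (2 * i + 1); c \<in> carrier G;
        holds M c (inst (a (2 * i + 1)) (\<phi> i))\<rbrakk> \<Longrightarrow>
        holds M (u \<otimes>\<^bsub>G\<^esub> c \<otimes>\<^bsub>G\<^esub> v) (inst (a (2 * i + 1)) (\<psi> (2 * i + 1)))"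
    by metis
  have "\<exists>c. \<forall>i<n. holds M c (inst (a (2 * i)) (\<phi> i)) \<and>
                     \<not> holds M c (inst (a (2 * i + 1)) (\<phi> i))" for n
  proof -
    obtain c where c: "\<And>K. subgroup K G \<Longrightarrow> \<forall>i<n. b (2 * i + 1) \<in> K \<Longrightarrow> c \<in> K"
      "\<And>i. i < n \<Longrightarrow> \<exists>u\<in>K (2 * i + 1). \<exists>v\<in>K (2 * i + 1). c = u \<otimes>\<^bsub>G\<^esub> b (2 * i + 1) \<otimes>\<^bsub>G\<^esub> v"
      using product_with_one_bad_factor_each[of n "\<lambda>i. K (2 * i + 1)" "\<lambda>i. b (2 * i + 1)"] K bG b(1)
      by auto
    have "c \<in> carrier G" using c(1)[OF subgroup_self] bG by simp
    have "holds M c (inst (a (2 * i)) (\<phi> i))" for i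
    proof (rule \<phi>(2))
      have "2 * i \<noteq> 2 * j + 1" for j by presburger
      then have "c \<in> K (2 * i)" using b(1) by (intro c(1) K) blast
      then show "c \<in> realisations M (inst (a (2 * i)) ` p (2 * i + 1))"
        by (simp add: K_def pairs)
    qed
    moreover have "\<not> holds M c (inst (a (2 * i + 1)) (\<phi> i))" if i: "i < n" for i
    proof
      assume holds: "holds M c (inst (a (2 * i + 1)) (\<phi> i))"
      define k where "k = 2 * i + 1"
      obtain u v where uv: "u \<in> K k" "v \<in> K k" "c = u \<otimes>\<^bsub>G\<^esub> b k \<otimes>\<^bsub>G\<^esub> v"
        using c(2)[OF i] unfolding k_def by blast
      then have "u \<in> carrier G" "v \<in> carrier G" using subgroup.mem_carrier[OF K] by auto
      then have "b k = inv\<^bsub>G\<^esub> u \<otimes>\<^bsub>G\<^esub> c \<otimes>\<^bsub>G\<^esub> inv\<^bsub>G\<^esub> v"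
        using bG[of k] by (simp add: uv(3) m_assoc inv_solve_left)
      moreover have "inv\<^bsub>G\<^esub> u \<in> K k" "inv\<^bsub>G\<^esub> v \<in> K k"
        using uv subgroup.m_inv_closed[OF K] by auto
      ultimately have "holds M (b k) (inst (a k) (\<psi> k))"
        using \<phi>(3)[of "inv\<^bsub>G\<^esub> u" i "inv\<^bsub>G\<^esub> v" c] \<open>c \<in> carrier G\<close> holds
        unfolding k_def by simp
      then show False using \<psi>(2) by blast
    qed
    ultimately show ?thesis by blast
  qed
  then have "\<not> strongly_dependent L M"
    by (rule alternation_not_strongly_dependent[OF sat unc ind \<phi>(1)])
  with dep show False by blast
qed

theorem lemma3p6:
  fixes L :: "('f, 'r) lang"
    and T :: "('f, 'r, nat) fm set"
    and \<CC> :: "('f, 'r, 'm) str"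
    and G :: "('x::finite \<Rightarrow> 'm) monoid"
  assumes "complete_theory L T"
    and "monster_model L T \<CC>"
    and "strongly_dependent L \<CC>"
    and "type_definable_group L \<CC> G"
    and "small \<CC> (UNIV :: 'y set)"
  shows
    "(\<forall>(p :: nat \<Rightarrow> ('f, 'r, 'x + 'y) fm set) (a :: nat \<Rightarrow> 'y \<Rightarrow> 'm).
        (\<forall>i. p i \<subseteq> formulas L) \<and>
        (\<forall>i. subgroup (realisations \<CC> (inst (a i) ` p i)) G) \<and>
        indiscernible L \<CC> {} UNIV a \<and>
        (\<forall>i. p (2 * i) = p (2 * i + 1)) \<longrightarrow>
        (\<exists>i. (\<Inter>j\<in>UNIV - {i}. realisations \<CC> (inst (a j) ` p j)) =
             (\<Inter>j. realisations \<CC> (inst (a j) ` p j))))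
     \<and>
     (\<forall>(p :: ('f, 'r, 'x + 'y) fm set) (a :: nat \<Rightarrow> 'y \<Rightarrow> 'm).
        p \<subseteq> formulas L \<and>
        (\<forall>i. subgroup (realisations \<CC> (inst (a i) ` p)) G) \<and>
        indiscernible L \<CC> {} UNIV a \<longrightarrow>
        (\<exists>i. (\<Inter>j\<in>UNIV - {i}. realisations \<CC> (inst (a j) ` p)) =
             (\<Inter>j. realisations \<CC> (inst (a j) ` p))))"
proof -
  have sat: "saturated L \<CC>" and unc: "small \<CC> (UNIV :: nat set)"
    using assms(2) by (auto simp: monster_model_def)
  note redundant = some_subgroup_is_redundant[OF sat unc assms(3-5)]
  show ?thesis
  proof (intro conjI allI impI; elim conjE)
    fix p :: "nat \<Rightarrow> ('f, 'r, 'x + 'y) fm set" and a :: "nat \<Rightarrow> 'y \<Rightarrow> 'm"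
    assume "\<forall>i. p i \<subseteq> formulas L" "\<forall>i. subgroup (realisations \<CC> (inst (a i) ` p i)) G"
      "indiscernible L \<CC> {} UNIV a" "\<forall>i. p (2 * i) = p (2 * i + 1)"
    then show "\<exists>i. (\<Inter>j\<in>UNIV - {i}. realisations \<CC> (inst (a j) ` p j)) =
                 (\<Inter>j. realisations \<CC> (inst (a j) ` p j))"
      by (intro redundant) blast+
  next
    fix p :: "('f, 'r, 'x + 'y) fm set" and a :: "nat \<Rightarrow> 'y \<Rightarrow> 'm"
    assume "p \<subseteq> formulas L" "\<forall>i. subgroup (realisations \<CC> (inst (a i) ` p)) G"
      "indiscernible L \<CC> {} UNIV a"
    then show "\<exists>i. (\<Inter>j\<in>UNIV - {i}. realisations \<CC> (inst (a j) ` p)) =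
                 (\<Inter>j. realisations \<CC> (inst (a j) ` p))"
      by (intro redundant[where p = "\<lambda>_. p"]) blast+
  qed
qed

end
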